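(* Let $K=\mathbb{F}_q$ be a finite field, let $v_1,\ldots,v_n$ be positive integers, and let $X\subset\mathbb{P}^{n-1}$ be the degenerate projective torus parameterized by $x_1^{v_1},\ldots,x_n^{v_n}$, with vanishing ideal $I(X)\subset S=K[t_1,\ldots,t_n]$. Let $\beta$ be a generator of the cyclic group $K^*$, let $d_i$ be the order of $\beta^{v_i}$ in $K^*$, and let $P\subset S$ be the toric ideal of $K[y_1^{d_1},\ldots,y_1^{d_n}]$. Then $I(X)$ is a complete intersection if and only if $P$ is a complete intersection.
   Context: $X=\{[(x_1^{v_1},\ldots,x_n^{v_n})] : x_i\in K^*\text{ for all }i\}\subset\mathbb{P}^{n-1}$, where $\mathbb{P}^{n-1}$ is the projective space over $K$ and $K^*=K\setminus\{0\}$. $S=K[t_1,\ldots,t_n]$ has the standard grading, and $I(X)$ is the ideal of $S$ generated by the homogeneous polynomials that vanish at all points of $X$. The toric ideal $P$ is the kernel of the $K$-algebra epimorphism $S\to K[y_1^{d_1},\ldots,y_1^{d_n}]\subset K[y_1]$, $t_i\mapsto y_1^{d_i}$, where $K[y_1]$ is a polynomial ring in one variable. An ideal $I\subset S$ is a complete intersection if $I=(f_1,\ldots,f_m)$ for some $f_1,\ldots,f_m\in S$ with $m=\mathrm{ht}(I)$. Both $P$ and $I(X)$ have height $n-1$. *)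

theory Defs
  imports
    "HOL-Analysis.Finite_Cartesian_Product"
    "HOL-Algebra.Algebraic_Closure_Type"
    "HOL-Algebra.Multiplicative_Group"
    "HOL-Library.Poly_Mapping"
    "HOL-Library.Extended_Nat"
begin

section \<open>Height and complete intersections\<close>

definition prime_height :: "('a, 'm) ring_scheme \<Rightarrow> 'a set \<Rightarrow> enat" where
  "prime_height R p = Sup {enat k | k. \<exists>C :: nat \<Rightarrow> 'a set.
     (\<forall>i\<le>k. primeideal (C i) R) \<and> (\<forall>i<k. C i \<subset> C (Suc i)) \<and> C k = p}"

text \<open>The unit ideal has height \<open>\<infinity>\<close>, being contained in no prime ideal.\<close>

definition ideal_height :: "('a, 'm) ring_scheme \<Rightarrow> 'a set \<Rightarrow> enat" where
  "ideal_height R I = Inf (prime_height R ` {p. primeideal p R \<and> I \<subseteq> p})"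

definition complete_intersection :: "('a, 'm) ring_scheme \<Rightarrow> 'a set \<Rightarrow> bool" where
  "complete_intersection R I \<longleftrightarrow>
     (\<exists>fs. set fs \<subseteq> carrier R \<and> I = Idl\<^bsub>R\<^esub> (set fs) \<and> enat (length fs) = ideal_height R I)"

section \<open>Polynomials in several variables\<close>

text \<open>
  The finite type \<^typ>\<open>'n\<close> indexes the variables \<open>t\<^sub>i\<close>. A monomial is its exponent vector
  and a polynomial is its coefficient function, so multiplication in this type is convolution,
  i.e. the product of \<open>K[t\<^sub>1,\<dots>,t\<^sub>n]\<close>.
\<close>

type_synonym ('n, 'k) mpoly = "('n \<Rightarrow>\<^sub>0 nat) \<Rightarrow>\<^sub>0 'k"

abbreviation mpoly_ring :: "('n::finite, 'k::field) mpoly ring" where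
  "mpoly_ring \<equiv> ring_of_type_algebra"

text \<open>
  The homomorphism \<open>S \<rightarrow> A\<close> sending \<open>t\<^sub>i\<close> to \<open>x i\<close> and acting as \<open>\<phi>\<close> on constants.
\<close>

definition mpoly_subst ::
    "('k::zero \<Rightarrow> 'a::comm_semiring_1) \<Rightarrow> ('n::finite \<Rightarrow> 'a) \<Rightarrow> ('n, 'k) mpoly \<Rightarrow> 'a" where
  "mpoly_subst \<phi> x f = (\<Sum>m\<in>Poly_Mapping.keys f. \<phi> (Poly_Mapping.lookup f m) *
     (\<Prod>i\<in>UNIV. x i ^ Poly_Mapping.lookup m i))"

abbreviation mpoly_eval :: "('n::finite, 'k::field) mpoly \<Rightarrow> 'k ^ 'n \<Rightarrow> 'k" where
  "mpoly_eval f x \<equiv> mpoly_subst (\<lambda>c. c) (\<lambda>i. x $ i) f"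

text \<open>The zero polynomial is homogeneous (of every degree).\<close>

definition homogeneous :: "('n::finite, 'k::zero) mpoly \<Rightarrow> bool" where
  "homogeneous f \<longleftrightarrow>
     (\<exists>e. \<forall>m\<in>Poly_Mapping.keys f. (\<Sum>i\<in>UNIV. Poly_Mapping.lookup m i) = e)"

abbreviation units_group :: "'k::field monoid" where
  "units_group \<equiv> mult_of ring_of_type_algebra"

section \<open>Projective space and vanishing ideals\<close>

text \<open>A point of projective space is the set of all its vectors of homogeneous coordinates.\<close>

definition proj_point :: "'k::field ^ 'n \<Rightarrow> ('k ^ 'n) set" where
  "proj_point x = {c *s x | c. c \<noteq> 0}"

definition projective_space :: "('k::field ^ 'n) set set" where
  "projective_space = proj_point ` (UNIV - {0})"

definition vanishing_ideal :: "('k::field ^ 'n::finite) set set \<Rightarrow> ('n, 'k) mpoly set" where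
  "vanishing_ideal Y =
     Idl\<^bsub>mpoly_ring\<^esub> {f. homogeneous f \<and> (\<forall>Q\<in>Y. \<forall>x\<in>Q. mpoly_eval f x = 0)}"

definition degenerate_torus :: "('n::finite \<Rightarrow> nat) \<Rightarrow> ('k::field ^ 'n) set set" where
  "degenerate_torus v = {proj_point (\<chi> i. x i ^ v i) | x. \<forall>i. x i \<noteq> 0}"

lemma degenerate_torus_subset: "degenerate_torus v \<subseteq> projective_space"
  by (auto simp: degenerate_torus_def projective_space_def vec_eq_iff)

section \<open>Toric ideals of monomial curves\<close>

text \<open>The kernel of \<open>S \<rightarrow> K[y]\<close>, \<open>t\<^sub>i \<mapsto> y ^ d\<^sub>i\<close>.\<close>

definition toric_ideal :: "('n::finite \<Rightarrow> nat) \<Rightarrow> ('n, 'k::field) mpoly set" where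
  "toric_ideal d = {f. mpoly_subst (\<lambda>c. [:c:]) (\<lambda>i. Polynomial.monom 1 (d i)) f = 0}"

end

theory Submission
  imports Defs
begin

text \<open>
  Let \<open>\<phi>\<close> be the endomorphism \<open>t\<^sub>i \<mapsto> t\<^sub>i ^ d\<^sub>i\<close> of \<open>S\<close>. Over its image, \<open>S\<close> is free on the monomials
  \<open>t ^ b\<close> with \<open>b\<^sub>i < d\<^sub>i\<close>, and orthogonality of the characters of the group of roots of unity
  \<open>\<zeta>\<close>, \<open>\<zeta>\<^sub>i ^ d\<^sub>i = 1\<close>, shows that \<open>I(X)\<close> is the extension of \<open>P\<close> along \<open>\<phi>\<close>. Extension preserves
  heights: freeness gives going down, and the group acting by \<open>t\<^sub>i \<mapsto> \<zeta>\<^sub>i t\<^sub>i\<close> gives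
  incomparability. So no height has to be computed, and it remains to compare numbers of
  generators. Generators of \<open>P\<close> extend to \<open>I(X)\<close>; conversely, the components in degree \<open>b = 0\<close> of
  generators of \<open>I(X)\<close> span \<open>P\<close> modulo \<open>\<mm>P\<close>, where they can be exchanged for at most as many
  weighted homogeneous elements, which generate \<open>P\<close> by the graded Nakayama lemma.
\<close>

section \<open>Ideals of commutative rings as submodules\<close>

text \<open>A commutative ring is a module over itself whose subspaces are exactly its ideals, so
  spans can serve as generated ideals.\<close>

interpretation idl: Modules.module "(*) :: 'a::comm_ring_1 \<Rightarrow> 'a \<Rightarrow> 'a"
  by unfold_locales (auto simp: algebra_simps)

declare idl.scale_scale [simp del] \<comment> \<open>loops with associativity of multiplication\<close>

lemma ideal_ring_of_type_iff:
  "ideal I (ring_of_type_algebra :: 'a::comm_ring_1 ring) \<longleftrightarrow> idl.subspace I" (is "?l \<longleftrightarrow> ?r")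
proof
  assume ?l
  then interpret ideal I "ring_of_type_algebra :: 'a ring" .
  show ?r
    using additive_subgroup.zero_closed[OF additive_subgroup_axioms]
      additive_subgroup.a_closed[OF additive_subgroup_axioms] I_l_closed
    by (auto simp: idl.subspace_def ring_of_type_algebra_def)
next
  assume r: ?r
  interpret cring "ring_of_type_algebra :: 'a ring"
    by (rule cring_from_type_algebra)
  have inv: "inv\<^bsub>add_monoid (ring_of_type_algebra :: 'a ring)\<^esub> x = - x" for x
    by (rule group.inv_equality[OF a_group]) (auto simp: ring_of_type_algebra_def)
  have "subgroup I (add_monoid (ring_of_type_algebra :: 'a ring))"
    by (rule subgroup.intro, unfold inv)
      (auto simp: ring_of_type_algebra_def intro: idl.subspace_add[OF r] idl.subspace_0[OF r]
        idl.subspace_neg[OF r])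
  then show ?l
  proof (rule idealI[OF ring_axioms])
    fix a x assume a: "a \<in> I"
    show "x \<otimes>\<^bsub>ring_of_type_algebra\<^esub> a \<in> I"
      using idl.subspace_scale[OF r a, of x] by (simp add: ring_of_type_algebra_def)
    show "a \<otimes>\<^bsub>ring_of_type_algebra\<^esub> x \<in> I"
      using idl.subspace_scale[OF r a, of x] by (simp add: ring_of_type_algebra_def mult.commute)
  qed
qed

lemma genideal_ring_of_type:
  "Idl\<^bsub>ring_of_type_algebra\<^esub> S = idl.span (S :: 'a::comm_ring_1 set)"
  by (simp add: genideal_def ideal_ring_of_type_iff idl.span_def hull_def)

section \<open>Prime ideals: existence and avoidance\<close>

definition is_prime_ideal :: "'a::comm_ring_1 set \<Rightarrow> bool" where
  "is_prime_ideal p \<longleftrightarrow> idl.subspace p \<and> 1 \<notin> p \<and> (\<forall>a b. a * b \<in> p \<longrightarrow> a \<in> p \<or> b \<in> p)"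

lemma primeideal_ring_of_type_iff:
  "primeideal p (ring_of_type_algebra :: 'a::comm_ring_1 ring) \<longleftrightarrow> is_prime_ideal p" (is "?l \<longleftrightarrow> ?r")
proof
  assume ?l
  then interpret primeideal p "ring_of_type_algebra :: 'a ring" .
  have "a * b \<in> p \<Longrightarrow> a \<in> p \<or> b \<in> p" for a b
    using I_prime[of a b] by (simp add: ring_of_type_algebra_def)
  moreover have "1 \<notin> p"
    using one_imp_carrier I_notcarr by (auto simp: ring_of_type_algebra_def)
  ultimately show ?r
    using is_ideal by (simp add: is_prime_ideal_def ideal_ring_of_type_iff)
next
  assume r: ?r
  then have "ideal p (ring_of_type_algebra :: 'a ring)"
    by (simp add: ideal_ring_of_type_iff is_prime_ideal_def)
  then show ?l
    by (rule primeidealI[OF _ cring_from_type_algebra])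
      (use r in \<open>simp_all add: is_prime_ideal_def ring_of_type_algebra_def, metis UNIV_I\<close>)
qed

lemma prime_ideal_subspace: "is_prime_ideal p \<Longrightarrow> idl.subspace p"
  by (simp add: is_prime_ideal_def)

lemma prime_ideal_prod:
  assumes "is_prime_ideal p" "finite A" "prod f A \<in> p"
  shows "\<exists>x\<in>A. f x \<in> p"
  using assms(2,3)
proof (induction A)
  case empty
  then show ?case using assms(1) by (simp add: is_prime_ideal_def)
next
  case (insert x A)
  then have "f x * prod f A \<in> p" by simp
  then have "f x \<in> p \<or> prod f A \<in> p" using assms(1) unfolding is_prime_ideal_def by blast
  then show ?case using insert.IH by blast
qed

text \<open>Zorn's lemma yields an ideal maximal among those that contain \<open>I\<close> and miss
  the multiplicative set \<open>M\<close>; maximality makes it prime.\<close>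

lemma exists_prime_ideal_disjoint:
  assumes I: "idl.subspace I" and M: "1 \<in> M" "\<And>a b. a \<in> M \<Longrightarrow> b \<in> M \<Longrightarrow> a * b \<in> M"
    and disj: "I \<inter> M = {}"
  obtains p where "is_prime_ideal p" "I \<subseteq> p" "p \<inter> M = {}"
proof -
  define \<A> where "\<A> = {J. idl.subspace J \<and> I \<subseteq> J \<and> J \<inter> M = {}}"
  have "\<exists>p\<in>\<A>. \<forall>Y\<in>\<A>. p \<subseteq> Y \<longrightarrow> Y = p"
  proof (rule subset_Zorn_nonempty)
    show "\<A> \<noteq> {}" using I disj by (auto simp: \<A>_def)
  next
    fix C assume C: "C \<noteq> {}" "subset.chain \<A> C"
    have sub: "\<And>J. J \<in> C \<Longrightarrow> idl.subspace J" and CA: "C \<subseteq> \<A>"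
      using C by (auto simp: subset_chain_def \<A>_def)
    have "idl.subspace (\<Union>C)"
    proof (rule idl.subspaceI)
      obtain J where "J \<in> C" using C(1) by blast
      then show "0 \<in> \<Union>C" using idl.subspace_0[OF sub] by blast
    next
      fix x y assume "x \<in> \<Union>C" "y \<in> \<Union>C"
      then obtain J where J: "J \<in> C" "x \<in> J" "y \<in> J"
        using C(2) unfolding subset_chain_def by blast
      then show "x + y \<in> \<Union>C" using idl.subspace_add[OF sub] by blast
    next
      fix c x assume "x \<in> \<Union>C"
      then show "c * x \<in> \<Union>C" using idl.subspace_scale[OF sub] by blast
    qed
    then show "\<Union>C \<in> \<A>" using C(1) CA by (auto simp: \<A>_def)
  qed
  then obtain p where p: "p \<in> \<A>" and max: "\<And>Y. Y \<in> \<A> \<Longrightarrow> p \<subseteq> Y \<Longrightarrow> Y = p"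
    by blast
  have sp: "idl.subspace p" and Ip: "I \<subseteq> p" and pM: "p \<inter> M = {}"
    using p by (auto simp: \<A>_def)
  \<comment> \<open>By maximality the ideal generated by \<open>p\<close> and \<open>a\<close> meets
    \<open>M\<close>, and an element of it is a multiple of \<open>a\<close> modulo
    \<open>p\<close>.\<close>
  have meet: "\<exists>k. \<exists>m\<in>M. m - k * a \<in> p" if "a \<notin> p" for a
  proof -
    have sup: "insert a p \<subseteq> idl.span (insert a p)"
      by (rule idl.span_superset)
    then have "idl.span (insert a p) \<noteq> p" using that by (metis insert_subset)
    then have "idl.span (insert a p) \<notin> \<A>"
      using max[of "idl.span (insert a p)"] sup by (meson insert_subset)
    moreover have "I \<subseteq> idl.span (insert a p)"
      using Ip sup by auto
    ultimately obtain m where "m \<in> M" "m \<in> idl.span (insert a p)"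
      by (auto simp: \<A>_def)
    moreover have "idl.span p = p" using sp by simp
    ultimately show ?thesis
      using idl.span_breakdown_eq[of m a p] by auto
  qed
  have "a \<in> p \<or> b \<in> p" if ab: "a * b \<in> p" for a b
  proof (rule ccontr)
    assume "\<not> ?thesis"
    then obtain k m l n where km: "m \<in> M" "m - k * a \<in> p" and ln: "n \<in> M" "n - l * b \<in> p"
      using meet by blast
    \<comment> \<open>Expanding the product of two such elements of \<open>M\<close> puts it into
      \<open>p\<close>, although \<open>M\<close> is closed under products and disjoint from
      \<open>p\<close>.\<close>
    have "m * n = n * (m - k * a) + k * a * (n - l * b) + k * l * (a * b)"
      by (simp add: algebra_simps)
    also have "\<dots> \<in> p"
      using idl.subspace_scale[OF sp km(2), of n] idl.subspace_scale[OF sp ln(2), of "k * a"]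
        idl.subspace_scale[OF sp ab, of "k * l"] by (simp only: idl.subspace_add[OF sp])
    finally show False using pM M(2)[OF km(1) ln(1)] by blast
  qed
  moreover have "1 \<notin> p" using pM M(1) by blast
  ultimately have "is_prime_ideal p"
    using sp by (simp add: is_prime_ideal_def)
  then show ?thesis by (rule that[OF _ Ip pM])
qed

lemma prime_avoidance:
  assumes "finite F" "\<And>p. p \<in> F \<Longrightarrow> is_prime_ideal p" "idl.subspace A" "A \<subseteq> \<Union>F"
  shows "\<exists>p\<in>F. A \<subseteq> p"
  using assms
proof (induction F rule: finite_psubset_induct)
  case (psubset F)
  show ?case
  proof (cases "\<exists>p\<in>F. A \<subseteq> \<Union>(F - {p})")
    case True
    then obtain p where "p \<in> F" "A \<subseteq> \<Union>(F - {p})" by blast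
    then have "\<exists>q\<in>F - {p}. A \<subseteq> q" using psubset by (intro psubset.IH) auto
    then show ?thesis by blast
  next
    case False
    then have "\<forall>p\<in>F. \<exists>x\<in>A. x \<notin> \<Union>(F - {p})" by blast
    then obtain x where x: "\<And>p. p \<in> F \<Longrightarrow> x p \<in> A" "\<And>p. p \<in> F \<Longrightarrow> x p \<notin> \<Union>(F - {p})"
      by metis
    have xp: "x p \<in> p" if "p \<in> F" for p
      using x[OF that] psubset.prems(3) by blast
    have "F \<noteq> {}" using psubset.prems(3) idl.subspace_0[OF psubset.prems(2)] by blast
    then obtain p where p: "p \<in> F" by blast
    show ?thesis
    \<comment> \<open>A single prime is set apart because the product below would be empty, and 1
      need not lie in \<open>A\<close>.\<close>
    proof (cases "F = {p}")
      case True
      then show ?thesis using psubset.prems(3) by auto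
    next
      case False
      then obtain q where q: "q \<in> F" "q \<noteq> p" using p by blast
      \<comment> \<open>The first summand lies in \<open>p\<close> alone, the second in every member
        except \<open>p\<close>; hence their sum can lie in no member.\<close>
      define y where "y = x p + (\<Prod>r\<in>F - {p}. x r)"
      have dvd: "(\<Prod>r\<in>F - {p}. x r) \<in> B" if "r \<in> F - {p}" "idl.subspace B" "x r \<in> B" for r B
      proof -
        have "x r dvd (\<Prod>r\<in>F - {p}. x r)"
          using that(1) psubset.hyps by (intro dvd_prodI) auto
        then show ?thesis
          using that idl.subspace_scale[of B "x r"] by (auto simp: dvd_def mult.commute)
      qed
      have "y \<in> A"
        unfolding y_def
        by (rule idl.subspace_add[OF psubset.prems(2) x(1)[OF p]])
          (use dvd[of q A] q x(1) psubset.prems(2) in simp)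
      then obtain r where r: "r \<in> F" "y \<in> r" using psubset.prems(3) by blast
      have sr: "idl.subspace r" using psubset.prems(1)[OF r(1)] by (rule prime_ideal_subspace)
      show ?thesis
      proof (cases "r = p")
        case True
        then have "(\<Prod>r\<in>F - {p}. x r) \<in> p"
          using r(2) xp[OF p] sr idl.subspace_diff[of p y "x p"] by (simp add: y_def)
        then obtain s where "s \<in> F - {p}" "x s \<in> p"
          using prime_ideal_prod[OF psubset.prems(1)[OF p], of "F - {p}" x] psubset.hyps by blast
        then show ?thesis using x(2)[of s] p by blast
      next
        case False
        then have "x p \<in> r"
          using r dvd[of r r] xp[of r] sr idl.subspace_diff[of r y "(\<Prod>r\<in>F - {p}. x r)"]
          by (simp add: y_def)
        then show ?thesis using x(2)[OF p] r(1) False by blast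
      qed
    qed
  qed
qed

section \<open>Heights under extension of ideals\<close>

lemma ideal_height_mono:
  assumes "\<And>p. is_prime_ideal p \<Longrightarrow> I \<subseteq> p \<Longrightarrow>
    \<exists>q. is_prime_ideal q \<and> J \<subseteq> q \<and> prime_height ring_of_type_algebra q \<le> prime_height ring_of_type_algebra p"
  shows "ideal_height ring_of_type_algebra (J :: 'b::comm_ring_1 set)
    \<le> ideal_height ring_of_type_algebra (I :: 'a::comm_ring_1 set)"
  unfolding ideal_height_def primeideal_ring_of_type_iff
  by (rule Inf_mono) (use assms in blast)

lemma prime_height_mono:
  assumes "\<And>k C. \<forall>i\<le>k. is_prime_ideal (C i) \<Longrightarrow> \<forall>i<k. C i \<subset> C (Suc i) \<Longrightarrow> C k = p \<Longrightarrow>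
    \<exists>D :: nat \<Rightarrow> 'b set. (\<forall>i\<le>k. is_prime_ideal (D i)) \<and> (\<forall>i<k. D i \<subset> D (Suc i)) \<and> D k = q"
  shows "prime_height ring_of_type_algebra (p :: 'a::comm_ring_1 set)
    \<le> prime_height ring_of_type_algebra (q :: 'b::comm_ring_1 set)"
  unfolding prime_height_def primeideal_ring_of_type_iff
proof (rule Sup_subset_mono, rule subsetI)
  fix x
  assume "x \<in> {enat k |k. \<exists>C. (\<forall>i\<le>k. is_prime_ideal (C i)) \<and> (\<forall>i<k. C i \<subset> C (Suc i)) \<and> C k = p}"
  then obtain k C where "x = enat k" and C: "\<forall>i\<le>k. is_prime_ideal (C i)" "\<forall>i<k. C i \<subset> C (Suc i)" "C k = p"
    by blast
  then show "x \<in> {enat k |k. \<exists>C. (\<forall>i\<le>k. is_prime_ideal (C i)) \<and> (\<forall>i<k. C i \<subset> C (Suc i)) \<and> C k = q}"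
    using assms[OF C] by blast
qed

section \<open>Contraction and lifting of primes along a ring homomorphism\<close>

locale ring_extension =
  fixes \<phi> :: "'a::comm_ring_1 \<Rightarrow> 'b::comm_ring_1"
  assumes add: "\<phi> (x + y) = \<phi> x + \<phi> y"
    and mult: "\<phi> (x * y) = \<phi> x * \<phi> y"
    and one: "\<phi> 1 = 1"
begin

lemma zero: "\<phi> 0 = 0"
  using add[of 0 0] by simp

definition extension :: "'a set \<Rightarrow> 'b set" where
  "extension I = idl.span (\<phi> ` I)"

lemma subspace_extension: "idl.subspace (extension I)"
  by (simp add: extension_def)

lemma extension_base: "x \<in> I \<Longrightarrow> \<phi> x \<in> extension I"
  by (simp add: extension_def idl.span_base)

lemma extension_subset_iff: "idl.subspace Q \<Longrightarrow> extension I \<subseteq> Q \<longleftrightarrow> I \<subseteq> \<phi> -` Q"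
  using idl.span_minimal[of "\<phi> ` I" Q] extension_base[of _ I] by (auto simp: extension_def)

lemma extension_span: "extension (idl.span S) = idl.span (\<phi> ` S)"
proof
  have "idl.subspace (\<phi> -` idl.span (\<phi> ` S))"
    by (rule idl.subspaceI) (auto simp: zero add mult intro: idl.span_add idl.span_scale idl.span_zero)
  moreover have "S \<subseteq> \<phi> -` idl.span (\<phi> ` S)"
    by (auto intro: idl.span_base)
  ultimately show "extension (idl.span S) \<subseteq> idl.span (\<phi> ` S)"
    by (simp add: extension_subset_iff idl.span_minimal)
next
  show "idl.span (\<phi> ` S) \<subseteq> extension (idl.span S)"
    unfolding extension_def by (intro idl.span_mono image_mono idl.span_superset)
qed

lemma prime_ideal_vimage:
  assumes "is_prime_ideal Q"
  shows "is_prime_ideal (\<phi> -` Q)"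
proof -
  have "idl.subspace (\<phi> -` Q)"
    using prime_ideal_subspace[OF assms]
    by (intro idl.subspaceI) (auto simp: zero add mult idl.subspace_0 idl.subspace_add idl.subspace_scale)
  then show ?thesis
    using assms by (auto simp: is_prime_ideal_def one mult)
qed

end

text \<open>Regularity, a weak form of flatness, supplies lying over (together with properness of
  the extension) and going down. Incomparability keeps contracted chains strict.\<close>

locale height_preserving_extension = ring_extension +
  assumes one_notin_extension: "is_prime_ideal p \<Longrightarrow> 1 \<notin> extension p"
    and regular: "is_prime_ideal p \<Longrightarrow> s \<notin> p \<Longrightarrow> \<phi> s * u \<in> extension p \<Longrightarrow> u \<in> extension p"
    and incomparable: "is_prime_ideal P \<Longrightarrow> is_prime_ideal Q \<Longrightarrow> P \<subseteq> Q \<Longrightarrow> \<phi> -` P = \<phi> -` Q \<Longrightarrow> P = Q"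
begin

text \<open>The image of the complement of \<open>p\<close> misses the extension of
  \<open>p\<close>. A prime that contains the extension and still misses this image contracts
  exactly to \<open>p\<close>.\<close>

lemma lying_over:
  assumes p: "is_prime_ideal p"
  obtains Q where "is_prime_ideal Q" "\<phi> -` Q = p"
proof -
  have "\<phi> s \<notin> extension p" if "s \<notin> p" for s
    using regular[OF p that, of 1] one_notin_extension[OF p] by auto
  moreover have "1 \<in> \<phi> ` (- p)"
    using p one by (force simp: is_prime_ideal_def)
  moreover have "a * b \<in> \<phi> ` (- p)" if ab: "a \<in> \<phi> ` (- p)" "b \<in> \<phi> ` (- p)" for a b
  proof -
    obtain s t where "a = \<phi> s" "b = \<phi> t" "s \<notin> p" "t \<notin> p"
      using ab by blast
    then show ?thesis using p mult[of s t, symmetric] unfolding is_prime_ideal_def by auto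
  qed
  ultimately obtain Q where Q: "is_prime_ideal Q" "extension p \<subseteq> Q" "Q \<inter> \<phi> ` (- p) = {}"
    using exists_prime_ideal_disjoint[OF subspace_extension, of "\<phi> ` (- p)" p] by blast
  have "\<phi> -` Q = p"
    using Q extension_base[of _ p] by blast
  then show ?thesis using that Q(1) by blast
qed

text \<open>Regularity makes the denominators \<open>s * u\<close>, with \<open>s\<close> outside \<open>p\<close> and \<open>u\<close> outside \<open>Q\<close>,
  avoid the extension of \<open>p\<close>.\<close>

lemma going_down:
  assumes p: "is_prime_ideal p" and Q: "is_prime_ideal Q" and pQ: "p \<subseteq> \<phi> -` Q"
  obtains P where "is_prime_ideal P" "P \<subseteq> Q" "\<phi> -` P = p"
proof -
  define M where "M = {\<phi> s * u | s u. s \<notin> p \<and> u \<notin> Q}"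
  have sub: "extension p \<subseteq> Q"
    using pQ prime_ideal_subspace[OF Q] by (simp add: extension_subset_iff)
  have "extension p \<inter> M = {}"
    using regular[OF p] sub by (auto simp: M_def)
  moreover have in1: "\<phi> s \<in> M" if "s \<notin> p" for s
  proof -
    have "\<phi> s = \<phi> s * 1" "1 \<notin> Q" using Q by (simp_all add: is_prime_ideal_def)
    then show ?thesis unfolding M_def using that by blast
  qed
  moreover have "1 \<in> M"
    using in1[of 1] p one by (simp add: is_prime_ideal_def)
  moreover have "a * b \<in> M" if ab: "a \<in> M" "b \<in> M" for a b
  proof -
    obtain s u t v where st: "a = \<phi> s * u" "b = \<phi> t * v" "s \<notin> p" "u \<notin> Q" "t \<notin> p" "v \<notin> Q"
      using ab by (auto simp: M_def)
    then have "a * b = \<phi> (s * t) * (u * v)" by (simp add: mult mult_ac)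
    moreover have "s * t \<notin> p" "u * v \<notin> Q" using st p Q by (auto simp: is_prime_ideal_def)
    ultimately show ?thesis unfolding M_def by blast
  qed
  ultimately obtain P where P: "is_prime_ideal P" "extension p \<subseteq> P" "P \<inter> M = {}"
    using exists_prime_ideal_disjoint[OF subspace_extension, of M p] by blast
  have "u \<in> M" if "u \<notin> Q" for u
  proof -
    have "u = \<phi> 1 * u" "1 \<notin> p" using p one by (simp_all add: is_prime_ideal_def)
    then show ?thesis unfolding M_def using that by blast
  qed
  then have "P \<subseteq> Q" using P(3) by blast
  moreover have "\<phi> -` P = p"
    using P(2,3) in1 extension_base[of _ p] by blast
  ultimately show ?thesis using that P(1) by blast
qed

lemma prime_height_le_vimage:
  assumes "is_prime_ideal Q"
  shows "prime_height ring_of_type_algebra Q \<le> prime_height ring_of_type_algebra (\<phi> -` Q)"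
proof (rule prime_height_mono)
  fix k and C :: "nat \<Rightarrow> 'b set"
  assume C: "\<forall>i\<le>k. is_prime_ideal (C i)" "\<forall>i<k. C i \<subset> C (Suc i)" "C k = Q"
  have "\<phi> -` C i \<subset> \<phi> -` C (Suc i)" if "i < k" for i
  proof -
    have "C i \<subset> C (Suc i)" "is_prime_ideal (C i)" "is_prime_ideal (C (Suc i))"
      using C that by auto
    then show ?thesis using incomparable[of "C i" "C (Suc i)"] by blast
  qed
  then show "\<exists>D. (\<forall>i\<le>k. is_prime_ideal (D i)) \<and> (\<forall>i<k. D i \<subset> D (Suc i)) \<and> D k = \<phi> -` Q"
    using C prime_ideal_vimage by (intro exI[of _ "\<lambda>i. \<phi> -` C i"]) auto
qed

text \<open>Going down is applied from the top prime \<open>Q\<close> downwards; the lifted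
  inclusions are strict because their contractions differ.\<close>

lemma chain_lift:
  assumes "\<forall>i\<le>k. is_prime_ideal (C i)" "\<forall>i<k. C i \<subset> C (Suc i)" "C k = \<phi> -` Q" "is_prime_ideal Q"
  shows "\<exists>D. (\<forall>i\<le>k. is_prime_ideal (D i)) \<and> (\<forall>i<k. D i \<subset> D (Suc i)) \<and> D k = Q"
  using assms
proof (induction k arbitrary: Q)
  case 0
  then show ?case by (intro exI[of _ "\<lambda>_. Q"]) auto
next
  case (Suc k)
  obtain P where P: "is_prime_ideal P" "P \<subseteq> Q" "\<phi> -` P = C k"
    using going_down[of "C k" Q] Suc.prems by force
  obtain D where D: "\<forall>i\<le>k. is_prime_ideal (D i)" "\<forall>i<k. D i \<subset> D (Suc i)" "D k = P"
    using Suc.IH[of P] Suc.prems P by auto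
  have "\<phi> -` P \<noteq> \<phi> -` Q" using P(3) Suc.prems(2,3) by auto
  then have "P \<subset> Q" using P(2) by blast
  then show ?case
    using D Suc.prems(4)
    by (intro exI[of _ "D(Suc k := Q)"]) (auto simp: le_Suc_eq less_Suc_eq)
qed

lemma vimage_prime_height_le:
  assumes "is_prime_ideal Q"
  shows "prime_height ring_of_type_algebra (\<phi> -` Q) \<le> prime_height ring_of_type_algebra Q"
  by (rule prime_height_mono) (rule chain_lift[OF _ _ _ assms])

text \<open>Primes above \<open>I\<close> are lifted by lying over, primes above the extension are
  contracted, and each prime is compared in height with its contraction.\<close>

theorem ideal_height_extension:
  "ideal_height ring_of_type_algebra (extension I) = ideal_height ring_of_type_algebra I"
proof (rule antisym)
  show "ideal_height ring_of_type_algebra (extension I) \<le> ideal_height ring_of_type_algebra I"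
  proof (rule ideal_height_mono)
    fix p assume p: "is_prime_ideal p" "I \<subseteq> p"
    obtain Q where Q: "is_prime_ideal Q" "\<phi> -` Q = p"
      using lying_over[OF p(1)] by blast
    then show "\<exists>q. is_prime_ideal q \<and> extension I \<subseteq> q \<and>
        prime_height ring_of_type_algebra q \<le> prime_height ring_of_type_algebra p"
      using p(2) prime_height_le_vimage[OF Q(1)] extension_subset_iff[OF prime_ideal_subspace[OF Q(1)]]
      by (intro exI[of _ Q]) simp
  qed
  show "ideal_height ring_of_type_algebra I \<le> ideal_height ring_of_type_algebra (extension I)"
  proof (rule ideal_height_mono)
    fix Q assume Q: "is_prime_ideal Q" "extension I \<subseteq> Q"
    then show "\<exists>p. is_prime_ideal p \<and> I \<subseteq> p \<and>
        prime_height ring_of_type_algebra p \<le> prime_height ring_of_type_algebra Q"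
      using vimage_prime_height_le[OF Q(1)] prime_ideal_vimage[OF Q(1)]
        extension_subset_iff[OF prime_ideal_subspace[OF Q(1)], of I] by blast
  qed
qed

end

section \<open>The endomorphism raising variables to powers\<close>

lemma poly_mapping_sum_single:
  "f = (\<Sum>m\<in>Poly_Mapping.keys f. Poly_Mapping.single m (Poly_Mapping.lookup f m))"
  by (rule poly_mapping_eqI) (simp add: lookup_sum lookup_single when_def in_keys_iff sum.delta)

lemma poly_mapping_induct [case_names single add]:
  fixes f :: "'m \<Rightarrow>\<^sub>0 'k::comm_monoid_add"
  assumes "\<And>m c. P (Poly_Mapping.single m c)" "\<And>f g. P f \<Longrightarrow> P g \<Longrightarrow> P (f + g)"
  shows "P f"
proof -
  have "P (\<Sum>m\<in>A. Poly_Mapping.single m (Poly_Mapping.lookup f m))" if "finite A" for A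
    using that
  proof induction
    case empty
    then show ?case using assms(1)[of undefined 0] by simp
  qed (simp add: assms)
  then show ?thesis by (metis finite_keys poly_mapping_sum_single)
qed

text \<open>The coefficient is an argument of \<open>\<psi>\<close> and not a scalar factor, so one
  construction covers substitutions, maps of exponents and coefficient functionals.\<close>

definition lin_ext :: "('m \<Rightarrow> 'k \<Rightarrow> 'c) \<Rightarrow> ('m \<Rightarrow>\<^sub>0 'k::zero) \<Rightarrow> 'c::comm_monoid_add" where
  "lin_ext \<psi> f = (\<Sum>m\<in>Poly_Mapping.keys f. \<psi> m (Poly_Mapping.lookup f m))"

lemma lin_ext_superset:
  assumes "finite A" "Poly_Mapping.keys f \<subseteq> A" "\<And>m. \<psi> m 0 = 0"
  shows "lin_ext \<psi> f = (\<Sum>m\<in>A. \<psi> m (Poly_Mapping.lookup f m))"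
  unfolding lin_ext_def using assms by (intro sum.mono_neutral_left) (auto simp: in_keys_iff)

lemma lin_ext_single: "\<psi> m 0 = 0 \<Longrightarrow> lin_ext \<psi> (Poly_Mapping.single m c) = \<psi> m c"
  by (simp add: lin_ext_def)

lemma lin_ext_add:
  assumes "\<And>m. \<psi> m 0 = 0" "\<And>m a b. \<psi> m (a + b) = \<psi> m a + \<psi> m b"
  shows "lin_ext \<psi> (f + g) = lin_ext \<psi> f + lin_ext \<psi> g"
proof -
  let ?A = "Poly_Mapping.keys f \<union> Poly_Mapping.keys g"
  have "finite ?A" "Poly_Mapping.keys (f + g) \<subseteq> ?A" "Poly_Mapping.keys f \<subseteq> ?A" "Poly_Mapping.keys g \<subseteq> ?A"
    using keys_add[of f g] by auto
  then show ?thesis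
    using assms by (simp add: lin_ext_superset[of ?A] lookup_add sum.distrib)
qed

lemma mpoly_subst_eq_lin_ext:
  "mpoly_subst \<phi> x = lin_ext (\<lambda>m c. \<phi> c * (\<Prod>i\<in>UNIV. x i ^ Poly_Mapping.lookup m i))"
  by (auto simp: mpoly_subst_def lin_ext_def)

section \<open>Division of exponent vectors by \<open>d\<close> with remainder\<close>

definition dilate :: "('n::finite \<Rightarrow> nat) \<Rightarrow> ('n \<Rightarrow>\<^sub>0 nat) \<Rightarrow> ('n \<Rightarrow>\<^sub>0 nat)" where
  "dilate d = Poly_Mapping.mapp (\<lambda>i x. d i * x)"

definition expo_div :: "('n::finite \<Rightarrow> nat) \<Rightarrow> ('n \<Rightarrow>\<^sub>0 nat) \<Rightarrow> ('n \<Rightarrow>\<^sub>0 nat)" where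
  "expo_div d = Poly_Mapping.mapp (\<lambda>i x. x div d i)"

definition expo_mod :: "('n::finite \<Rightarrow> nat) \<Rightarrow> ('n \<Rightarrow>\<^sub>0 nat) \<Rightarrow> ('n \<Rightarrow>\<^sub>0 nat)" where
  "expo_mod d = Poly_Mapping.mapp (\<lambda>i x. x mod d i)"

lemma lookup_dilate [simp]: "Poly_Mapping.lookup (dilate d m) i = d i * Poly_Mapping.lookup m i"
  by (simp add: dilate_def lookup_mapp when_def in_keys_iff)

lemma lookup_expo_div [simp]: "Poly_Mapping.lookup (expo_div d m) i = Poly_Mapping.lookup m i div d i"
  by (simp add: expo_div_def lookup_mapp when_def in_keys_iff)

lemma lookup_expo_mod [simp]: "Poly_Mapping.lookup (expo_mod d m) i = Poly_Mapping.lookup m i mod d i"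
  by (simp add: expo_mod_def lookup_mapp when_def in_keys_iff)

lemma dilate_add: "dilate d (m + m') = dilate d m + dilate d m'"
  by (rule poly_mapping_eqI) (simp add: lookup_add algebra_simps)

lemma dilate_0 [simp]: "dilate d 0 = 0"
  by (rule poly_mapping_eqI) simp

lemma expo_mod_add_dilate_div: "expo_mod d m + dilate d (expo_div d m) = m"
  by (rule poly_mapping_eqI) (simp add: lookup_add)

lemma expo_mod_dilate_add: "expo_mod d (dilate d m + m') = expo_mod d m'"
  by (rule poly_mapping_eqI) (simp add: lookup_add)

lemma expo_div_dilate_add: "(\<And>i. d i > 0) \<Longrightarrow> expo_div d (dilate d m + m') = m + expo_div d m'"
  by (rule poly_mapping_eqI) (simp add: lookup_add)

lemma finite_range_expo_mod:
  assumes "\<And>i. d i > 0"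
  shows "finite (range (expo_mod d))"
proof -
  have "finite (Poly_Mapping.lookup ` range (expo_mod d))"
    by (rule finite_subset[OF _ finite_PiE[of UNIV "\<lambda>i. {..<d i}"]]) (auto simp: assms)
  then show ?thesis
    by (rule finite_imageD) (auto simp: inj_on_def poly_mapping.lookup_inject)
qed

text \<open>This is the endomorphism \<phi> of the overview, raising the variable of index
  \<open>i\<close> to the power \<open>d i\<close>.\<close>

definition inflate :: "('n::finite \<Rightarrow> nat) \<Rightarrow> ('n, 'k::field) mpoly \<Rightarrow> ('n, 'k) mpoly" where
  "inflate d = lin_ext (\<lambda>m. Poly_Mapping.single (dilate d m))"

text \<open>The part of \<open>f\<close> with exponents congruent to \<open>b\<close> modulo \<open>d\<close>, divided by \<open>t ^ b\<close> and deflated.\<close>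

definition slice :: "('n::finite \<Rightarrow> nat) \<Rightarrow> ('n \<Rightarrow>\<^sub>0 nat) \<Rightarrow> ('n, 'k::field) mpoly \<Rightarrow> ('n, 'k) mpoly" where
  "slice d b = lin_ext (\<lambda>m c. if expo_mod d m = b then Poly_Mapping.single (expo_div d m) c else 0)"

lemma inflate_single [simp]: "inflate d (Poly_Mapping.single m c) = Poly_Mapping.single (dilate d m) c"
  by (simp add: inflate_def lin_ext_single)

lemma inflate_add: "inflate d (f + g) = inflate d f + inflate d g"
  unfolding inflate_def by (rule lin_ext_add) (simp_all add: single_add)

lemma inflate_mult: "inflate d (f * g) = inflate d f * inflate d g"
proof (induction f rule: poly_mapping_induct)
  case (single m c)
  show ?case
    by (induction g rule: poly_mapping_induct) (simp_all add: mult_single dilate_add distrib_left inflate_add)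
qed (simp add: distrib_right inflate_add)

lemma inflate_one: "inflate d 1 = 1"
  using inflate_single[of d 0 1] by (simp del: inflate_single add: single_one)

interpretation inflate: ring_extension "inflate d"
  by unfold_locales (simp_all add: inflate_add inflate_mult inflate_one)

lemma slice_single [simp]: "slice d b (Poly_Mapping.single m c) =
    (if expo_mod d m = b then Poly_Mapping.single (expo_div d m) c else 0)"
  by (simp add: slice_def lin_ext_single)

lemma slice_add: "slice d b (f + g) = slice d b f + slice d b g"
  unfolding slice_def by (rule lin_ext_add) (simp_all add: single_add)

lemma slice_0 [simp]: "slice d b 0 = 0"
  using slice_add[of d b 0 0] by simp

text \<open>Inflated exponents are multiples of \<open>d\<close>, so multiplying by them preserves
  residues and adds to quotients: slices are linear over the image of
  \<open>inflate d\<close>.\<close>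

lemma slice_inflate_mult:
  assumes "\<And>i. d i > 0"
  shows "slice d b (inflate d f * g) = f * slice d b g"
proof (induction f rule: poly_mapping_induct)
  case (single m c)
  show ?case
    by (induction g rule: poly_mapping_induct)
      (simp_all add: mult_single expo_mod_dilate_add expo_div_dilate_add assms distrib_left slice_add)
qed (simp add: distrib_right inflate_add slice_add)

lemma slice_zero_inflate:
  assumes "\<And>i. d i > 0"
  shows "slice d 0 (inflate d f) = f"
proof -
  have "expo_mod d 0 = 0" "expo_div d 0 = 0" by (auto intro: poly_mapping_eqI)
  then have "slice d 0 1 = (1 :: ('a, 'b) mpoly)"
    using slice_single[of d 0 0 1] by (simp del: slice_single add: single_one)
  then show ?thesis using slice_inflate_mult[where b = 0 and f = f and g = 1, OF assms] by simp
qed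

text \<open>The monomials with reduced exponents span \<open>S\<close> over the image of
  \<open>inflate d\<close>, and the slices are the coordinates.\<close>

lemma inflate_slice_decomposition:
  assumes "\<And>i. d i > 0"
  shows "f = (\<Sum>b\<in>range (expo_mod d). Poly_Mapping.single b 1 * inflate d (slice d b f))"
proof (induction f rule: poly_mapping_induct)
  case (single m c)
  have "(\<Sum>b\<in>range (expo_mod d). Poly_Mapping.single b 1 * inflate d (slice d b (Poly_Mapping.single m c)))
      = (\<Sum>b\<in>range (expo_mod d). if expo_mod d m = b then Poly_Mapping.single m c else 0)"
  proof (rule sum.cong[OF refl])
    fix b
    show "Poly_Mapping.single b 1 * inflate d (slice d b (Poly_Mapping.single m c))
      = (if expo_mod d m = b then Poly_Mapping.single m c else 0)"
      using expo_mod_add_dilate_div[of d m]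
      by (cases "expo_mod d m = b") (auto simp: mult_single inflate.zero)
  qed
  then show ?case using finite_range_expo_mod[of d, OF assms] by (simp add: sum.delta)
next
  case (add f g)
  show ?case
    by (subst (1) add(1), subst (1) add(2))
      (simp add: slice_add inflate_add distrib_left sum.distrib)
qed

text \<open>In a free module the extended ideal consists of the elements whose coordinates all lie
  in \<open>I\<close>.\<close>

lemma mem_extension_iff:
  assumes d: "\<And>i. d i > 0" and I: "idl.subspace I"
  shows "f \<in> inflate.extension d I \<longleftrightarrow> (\<forall>b. slice d b f \<in> I)"
proof
  assume "f \<in> inflate.extension d I"
  then show "\<forall>b. slice d b f \<in> I"
    unfolding inflate.extension_def
  proof (induction rule: idl.span_induct_alt)
    case base
    then show ?case using idl.subspace_0[OF I] by simp
  next
    case (step c x y)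
    then obtain p where p: "p \<in> I" "x = inflate d p" by blast
    have "slice d b (c * x) \<in> I" for b
      using slice_inflate_mult[where b = b and f = p and g = c, OF d] idl.subspace_scale[OF I p(1), of "slice d b c"] p(2)
      by (simp add: mult.commute)
    then show ?case using step idl.subspace_add[OF I] by (simp add: slice_add)
  qed
next
  assume *: "\<forall>b. slice d b f \<in> I"
  have "(\<Sum>b\<in>range (expo_mod d). Poly_Mapping.single b 1 * inflate d (slice d b f)) \<in> inflate.extension d I"
    using inflate.subspace_extension
    by (intro idl.subspace_sum idl.subspace_scale inflate.extension_base) (use * in auto)
  then show "f \<in> inflate.extension d I"
    using inflate_slice_decomposition[of d f, OF d] by simp
qed

section \<open>Conjugation by roots of unity\<close>

text \<open>The substitution multiplying the variable of index \<open>i\<close> by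
  \<open>\<zeta> i\<close>. If every \<open>\<zeta> i ^ d i\<close> is 1, it fixes the image of
  \<open>inflate d\<close> pointwise.\<close>

definition twist :: "('n::finite \<Rightarrow> 'k::field) \<Rightarrow> ('n, 'k) mpoly \<Rightarrow> ('n, 'k) mpoly" where
  "twist \<zeta> = lin_ext (\<lambda>m c. Poly_Mapping.single m (c * (\<Prod>i\<in>UNIV. \<zeta> i ^ Poly_Mapping.lookup m i)))"

lemma twist_single [simp]: "twist \<zeta> (Poly_Mapping.single m c) =
    Poly_Mapping.single m (c * (\<Prod>i\<in>UNIV. \<zeta> i ^ Poly_Mapping.lookup m i))"
  by (simp add: twist_def lin_ext_single)

lemma twist_add: "twist \<zeta> (f + g) = twist \<zeta> f + twist \<zeta> g"
  unfolding twist_def by (rule lin_ext_add) (simp_all add: distrib_right single_add)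

lemma twist_mult: "twist \<zeta> (f * g) = twist \<zeta> f * twist \<zeta> g"
proof (induction f rule: poly_mapping_induct)
  case (single m c)
  show ?case
    by (induction g rule: poly_mapping_induct)
      (simp_all add: mult_single lookup_add power_add prod.distrib mult_ac distrib_right twist_add)
qed (simp add: distrib_right twist_add)

lemma twist_one_poly: "twist \<zeta> 1 = 1"
  using twist_single[of \<zeta> 0 1] by (simp del: twist_single add: single_one)

interpretation twist: ring_extension "twist \<zeta>"
  by unfold_locales (simp_all add: twist_add twist_mult twist_one_poly)

lemma twist_const_one: "twist (\<lambda>_. 1) f = f"
  by (induction f rule: poly_mapping_induct) (simp_all add: twist_add)

lemma twist_twist: "twist \<zeta> (twist \<eta> f) = twist (\<lambda>i. \<zeta> i * \<eta> i) f"
  by (induction f rule: poly_mapping_induct)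
    (simp_all add: twist_add power_mult_distrib prod.distrib mult_ac)

lemma twist_funpow: "(twist \<zeta> ^^ k) f = twist (\<lambda>i. \<zeta> i ^ k) f"
  by (induction k) (simp_all add: twist_const_one twist_twist)

lemma twist_prod: "twist \<zeta> (\<Prod>x\<in>A. f x) = (\<Prod>x\<in>A. twist \<zeta> (f x))"
  by (induction A rule: infinite_finite_induct) (simp_all add: twist_mult twist_one_poly)

lemma lookup_twist: "Poly_Mapping.lookup (twist \<zeta> f) m =
    Poly_Mapping.lookup f m * (\<Prod>i\<in>UNIV. \<zeta> i ^ Poly_Mapping.lookup m i)"
  by (induction f rule: poly_mapping_induct)
    (simp_all add: lookup_single when_def twist_add lookup_add distrib_right)

lemma inflate_sum: "inflate d (\<Sum>x\<in>A. f x) = (\<Sum>x\<in>A. inflate d (f x))"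
  by (induction A rule: infinite_finite_induct) (simp_all add: inflate_add inflate.zero)

lemma in_range_inflate:
  assumes "\<And>m i. m \<in> Poly_Mapping.keys f \<Longrightarrow> d i dvd Poly_Mapping.lookup m i"
  shows "f \<in> range (inflate d)"
proof -
  have "dilate d (expo_div d m) = m" if "m \<in> Poly_Mapping.keys f" for m
    using assms[OF that] by (intro poly_mapping_eqI) simp
  then have "inflate d (\<Sum>m\<in>Poly_Mapping.keys f. Poly_Mapping.single (expo_div d m) (Poly_Mapping.lookup f m))
      = (\<Sum>m\<in>Poly_Mapping.keys f. Poly_Mapping.single m (Poly_Mapping.lookup f m))"
    by (simp add: inflate_sum)
  also have "\<dots> = f"
    by (rule poly_mapping_sum_single[symmetric])
  finally show ?thesis by (metis rangeI)
qed

section \<open>Norms over the group of roots of unity\<close>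

definition root_group :: "('n \<Rightarrow> nat) \<Rightarrow> ('n \<Rightarrow> 'k::field) set" where
  "root_group d = {\<zeta>. \<forall>i. \<zeta> i ^ d i = 1}"

lemma root_group_nonzero: "\<zeta> \<in> root_group d \<Longrightarrow> d i > 0 \<Longrightarrow> \<zeta> i \<noteq> 0"
  unfolding root_group_def by (metis (mono_tags) mem_Collect_eq neq0_conv power_0_left zero_neq_one)

lemma bij_betw_root_group:
  assumes "\<And>i. d i > 0" "\<eta> \<in> root_group d"
  shows "bij_betw (\<lambda>\<zeta> i. \<eta> i * \<zeta> i) (root_group d) (root_group d)"
proof (rule bij_betw_byWitness[where f' = "\<lambda>\<zeta> i. inverse (\<eta> i) * \<zeta> i"])
  show "(\<lambda>\<zeta> i. \<eta> i * \<zeta> i) ` root_group d \<subseteq> root_group d"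
    "(\<lambda>\<zeta> i. inverse (\<eta> i) * \<zeta> i) ` root_group d \<subseteq> root_group d"
    using assms(2) by (auto simp: root_group_def power_mult_distrib power_inverse)
qed (use root_group_nonzero[OF assms(2,1)] in \<open>auto simp: fun_eq_iff\<close>)

definition root_norm :: "('n::finite \<Rightarrow> nat) \<Rightarrow> ('n, 'k::field) mpoly \<Rightarrow> ('n, 'k) mpoly" where
  "root_norm d f = (\<Prod>\<zeta>\<in>root_group d. twist \<zeta> f)"

text \<open>Multiplication by \<eta> permutes the group and thereby the factors of the norm.\<close>

lemma twist_root_norm:
  assumes "\<And>i. d i > 0" "\<eta> \<in> root_group d"
  shows "twist \<eta> (root_norm d f) = root_norm d f"
  unfolding root_norm_def twist_prod twist_twist
  by (rule prod.reindex_bij_betw[OF bij_betw_root_group[of d, OF assms], of "\<lambda>\<zeta>. twist \<zeta> f"])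

text \<open>The second assumption says that \<open>\<omega> i\<close> has order exactly
  \<open>d i\<close>. In the application \<open>\<omega> i\<close> is
  \<open>\<beta> ^ v i\<close>.\<close>

locale primitive_roots =
  fixes d :: "'n::finite \<Rightarrow> nat" and \<omega> :: "'n \<Rightarrow> 'k::{field,finite}"
  assumes d_pos: "d i > 0"
    and root_power: "\<omega> i ^ k = 1 \<longleftrightarrow> d i dvd k"
begin

lemma root_norm_in_range: "root_norm d (f :: ('n, 'k) mpoly) \<in> range (inflate d)"
proof (rule in_range_inflate)
  fix m i assume m: "m \<in> Poly_Mapping.keys (root_norm d f)"
  \<comment> \<open>Twisting only the variable of index \<open>i\<close> multiplies the coefficient
    at \<open>m\<close> by \<open>\<omega> i\<close> to the power \<open>m\<close> at
    \<open>i\<close>; an invariant nonzero coefficient forces this factor to be 1.\<close>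
  define \<eta> where "\<eta> j = (if j = i then \<omega> i else 1)" for j
  have "\<eta> \<in> root_group d" by (auto simp: root_group_def \<eta>_def root_power)
  then have "Poly_Mapping.lookup (twist \<eta> (root_norm d f)) m = Poly_Mapping.lookup (root_norm d f) m"
    by (simp add: twist_root_norm d_pos)
  then have "(\<Prod>j\<in>UNIV. \<eta> j ^ Poly_Mapping.lookup m j) = 1"
    using m by (simp add: lookup_twist in_keys_iff)
  also have "(\<Prod>j\<in>UNIV. \<eta> j ^ Poly_Mapping.lookup m j)
      = (\<Prod>j\<in>UNIV. if j = i then \<omega> i ^ Poly_Mapping.lookup m i else 1)"
    by (rule prod.cong) (auto simp: \<eta>_def)
  finally show "d i dvd Poly_Mapping.lookup m i"
    by (simp add: root_power prod.delta)
qed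

text \<open>If \<open>P \<subseteq> Q\<close> lie over the same prime, norms show that \<open>Q\<close> is covered by the conjugates of
  \<open>P\<close>, so it lies in one of them; as the conjugation has finite order, \<open>Q \<subseteq> P\<close>.\<close>

lemma inflate_incomparable:
  assumes P: "is_prime_ideal P" and Q: "is_prime_ideal (Q :: ('n, 'k) mpoly set)" and PQ: "P \<subseteq> Q"
    and eq: "inflate d -` P = inflate d -` Q"
  shows "P = Q"
proof -
  let ?G = "root_group d :: ('n \<Rightarrow> 'k) set"
  have "Q \<subseteq> \<Union>((\<lambda>\<zeta>. twist \<zeta> -` P) ` ?G)"
  proof
    fix x assume x: "x \<in> Q"
    have "(\<lambda>_. 1) \<in> ?G" by (simp add: root_group_def)
    then have "root_norm d x = (\<Prod>\<zeta>\<in>?G - {\<lambda>_. 1}. twist \<zeta> x) * x"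
      unfolding root_norm_def by (subst prod.remove[of _ "\<lambda>_. 1"]) (simp_all add: twist_const_one mult.commute)
    then have "root_norm d x \<in> Q"
      using idl.subspace_scale[OF prime_ideal_subspace[OF Q] x] by simp
    moreover obtain y where "root_norm d x = inflate d y" using root_norm_in_range[of x] by blast
    ultimately have "root_norm d x \<in> P" using eq by auto
    then show "x \<in> \<Union>((\<lambda>\<zeta>. twist \<zeta> -` P) ` ?G)"
      using prime_ideal_prod[OF P, of ?G "\<lambda>\<zeta>. twist \<zeta> x"] by (auto simp: root_norm_def)
  qed
  then have "\<exists>p\<in>(\<lambda>\<zeta>. twist \<zeta> -` P) ` ?G. Q \<subseteq> p"
    using P Q by (intro prime_avoidance) (auto intro: twist.prime_ideal_vimage prime_ideal_subspace)
  then obtain \<zeta> where \<zeta>: "\<zeta> \<in> ?G" "Q \<subseteq> twist \<zeta> -` P" by blast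
  \<comment> \<open>A common multiple of all \<open>d i\<close>, so that the \<open>N\<close>-th
    iterate of the conjugation is the identity.\<close>
  define N where "N = (\<Prod>i\<in>UNIV. d i)"
  have N: "\<zeta> i ^ N = 1" for i
  proof -
    have "d i dvd N" by (auto simp: N_def intro: dvd_prodI)
    then show ?thesis using \<zeta>(1) by (auto simp: root_group_def dvd_def power_mult)
  qed
  have Npos: "N > 0" by (simp add: N_def d_pos prod_pos)
  \<comment> \<open>Each application sends \<open>Q\<close> into \<open>P\<close>, hence back into
    \<open>Q\<close>. At least one is required, which is why the exponent is a successor.\<close>
  have "(twist \<zeta> ^^ Suc k) x \<in> P" if "x \<in> Q" for x k
    using that \<zeta>(2) PQ by (induction k) auto
  moreover have "(twist \<zeta> ^^ N) x = x" for x
    using N by (simp add: twist_funpow twist_const_one)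
  ultimately have "x \<in> P" if "x \<in> Q" for x
    using that Npos by (metis Suc_pred)
  then show ?thesis using PQ by blast
qed

text \<open>Membership in the extension is tested slice by slice and slices are linear over the
  image, so regularity reduces to primality of \<open>p\<close>.\<close>

lemma inflate_height_preserving: "height_preserving_extension (inflate d :: ('n, 'k) mpoly \<Rightarrow> _)"
proof unfold_locales
  fix p :: "('n, 'k) mpoly set" assume p: "is_prime_ideal p"
  have mem: "f \<in> inflate.extension d p \<longleftrightarrow> (\<forall>b. slice d b f \<in> p)" for f
    by (rule mem_extension_iff[OF d_pos prime_ideal_subspace[OF p]])
  show "1 \<notin> inflate.extension d p"
    using slice_zero_inflate[of d "1 :: ('n, 'k) mpoly", OF d_pos] p unfolding mem is_prime_ideal_def
    by (intro notI) (metis inflate_one)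
  fix s u assume "s \<notin> p" "inflate d s * u \<in> inflate.extension d p"
  then show "u \<in> inflate.extension d p"
    using p by (auto simp: mem slice_inflate_mult d_pos is_prime_ideal_def)
qed (rule inflate_incomparable)

lemma ideal_height_inflate:
  "ideal_height ring_of_type_algebra (inflate.extension d I) =
   ideal_height ring_of_type_algebra (I :: ('n, 'k) mpoly set)"
  by (rule height_preserving_extension.ideal_height_extension[OF inflate_height_preserving])

end

section \<open>Toric ideals and Fourier inversion\<close>

definition weight :: "('n::finite \<Rightarrow> nat) \<Rightarrow> ('n \<Rightarrow>\<^sub>0 nat) \<Rightarrow> nat" where
  "weight d m = (\<Sum>i\<in>UNIV. d i * Poly_Mapping.lookup m i)"

definition weight_part :: "('n::finite \<Rightarrow> nat) \<Rightarrow> nat \<Rightarrow> ('n, 'k::field) mpoly \<Rightarrow> ('n, 'k) mpoly" where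
  "weight_part d e = lin_ext (\<lambda>m c. if weight d m = e then Poly_Mapping.single m c else 0)"

text \<open>The coefficient of \<open>y ^ e\<close> in the image of \<open>f\<close> under the map
  that defines the toric ideal.\<close>

definition weight_sum :: "('n::finite \<Rightarrow> nat) \<Rightarrow> nat \<Rightarrow> ('n, 'k::field) mpoly \<Rightarrow> 'k" where
  "weight_sum d e = lin_ext (\<lambda>m c. if weight d m = e then c else 0)"

lemma weight_add: "weight d (m + m') = weight d m + weight d m'"
  by (simp add: weight_def lookup_add distrib_left sum.distrib)

lemma weight_part_single [simp]: "weight_part d e (Poly_Mapping.single m c) =
    (if weight d m = e then Poly_Mapping.single m c else 0)"
  by (simp add: weight_part_def lin_ext_single)

lemma weight_part_add: "weight_part d e (f + g) = weight_part d e f + weight_part d e g"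
  unfolding weight_part_def by (rule lin_ext_add) (simp_all add: single_add)

lemma weight_sum_single [simp]: "weight_sum d e (Poly_Mapping.single m c) = (if weight d m = e then c else 0)"
  by (simp add: weight_sum_def lin_ext_single)

lemma weight_sum_add: "weight_sum d e (f + g) = weight_sum d e f + weight_sum d e g"
  unfolding weight_sum_def by (rule lin_ext_add) simp_all

lemma weight_sum_0 [simp]: "weight_sum d e 0 = 0"
  by (simp add: weight_sum_def lin_ext_def)

lemma lookup_weight_part:
  "Poly_Mapping.lookup (weight_part d e f) m = (if weight d m = e then Poly_Mapping.lookup f m else 0)"
  by (induction f rule: poly_mapping_induct)
    (auto simp: lookup_single when_def weight_part_add lookup_add)

lemma weight_part_weight_part:
  "weight_part d e (weight_part d e' f) = (if e = e' then weight_part d e f else 0)"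
  by (rule poly_mapping_eqI) (simp add: lookup_weight_part)

lemma weight_part_decomposition: "f = (\<Sum>e\<in>weight d ` Poly_Mapping.keys f. weight_part d e f)"
  by (rule poly_mapping_eqI) (auto simp: lookup_sum lookup_weight_part sum.delta in_keys_iff)

lemma weight_sum_weight_part:
  "weight_sum d e (weight_part d e' f) = (if e = e' then weight_sum d e f else 0)"
  by (induction f rule: poly_mapping_induct) (simp_all add: weight_part_add weight_sum_add)

lemma weight_sum_single_mult: "weight_sum d e (Poly_Mapping.single m c * f) =
    (if weight d m \<le> e then c * weight_sum d (e - weight d m) f else 0)"
  by (induction f rule: poly_mapping_induct)
    (auto simp: mult_single weight_add weight_sum_add distrib_left)

lemma mpoly_subst_single: "\<phi> 0 = 0 \<Longrightarrow> mpoly_subst \<phi> x (Poly_Mapping.single m c) =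
    \<phi> c * (\<Prod>i\<in>UNIV. x i ^ Poly_Mapping.lookup m i)"
  by (simp add: mpoly_subst_eq_lin_ext lin_ext_single)

lemma mpoly_subst_add:
  assumes "\<phi> 0 = 0" "\<And>a b. \<phi> (a + b) = \<phi> a + \<phi> b"
  shows "mpoly_subst \<phi> x (f + g) = mpoly_subst \<phi> x f + mpoly_subst \<phi> x g"
  unfolding mpoly_subst_eq_lin_ext by (rule lin_ext_add) (simp_all add: assms distrib_right)

lemma prod_monom: "(\<Prod>i\<in>A. Polynomial.monom 1 (k i)) = Polynomial.monom (1 :: 'a::comm_semiring_1) (\<Sum>i\<in>A. k i)"
  by (induction A rule: infinite_finite_induct) (simp_all add: mult_monom)

lemma coeff_mpoly_subst_monom:
  fixes f :: "('n::finite, 'k::field) mpoly"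
  shows "poly.coeff (mpoly_subst (\<lambda>c. [:c:]) (\<lambda>i. Polynomial.monom 1 (d i)) f) e = weight_sum d e f"
proof (induction f rule: poly_mapping_induct)
  case (single m c)
  have "(\<Prod>i\<in>UNIV. Polynomial.monom (1 :: 'k) (d i) ^ Poly_Mapping.lookup m i) = Polynomial.monom 1 (weight d m)"
    by (simp add: monom_power prod_monom weight_def)
  then show ?case by (simp add: mpoly_subst_single)
qed (simp add: mpoly_subst_add weight_sum_add)

lemma mem_toric_ideal_iff: "f \<in> toric_ideal d \<longleftrightarrow> (\<forall>e. weight_sum d e f = 0)"
  by (simp add: toric_ideal_def poly_eq_iff coeff_mpoly_subst_monom)

lemma subspace_toric_ideal: "idl.subspace (toric_ideal d)"
proof (rule idl.subspaceI)
  fix c x :: "('a, 'b) mpoly" assume x: "x \<in> toric_ideal d"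
  then have "weight_sum d e (c * x) = 0" for e
    by (induction c arbitrary: e rule: poly_mapping_induct)
      (simp_all add: mem_toric_ideal_iff weight_sum_single_mult distrib_right weight_sum_add)
  then show "c * x \<in> toric_ideal d" by (simp add: mem_toric_ideal_iff)
qed (simp_all add: mem_toric_ideal_iff weight_sum_add)

lemma weight_part_toric_ideal: "f \<in> toric_ideal d \<Longrightarrow> weight_part d e f \<in> toric_ideal d"
  by (simp add: mem_toric_ideal_iff weight_sum_weight_part)

lemma keys_inflate: "Poly_Mapping.keys (inflate d f) \<subseteq> dilate d ` Poly_Mapping.keys f"
  using keys_sum[of "\<lambda>m. Poly_Mapping.single (dilate d m) (Poly_Mapping.lookup f m)" "Poly_Mapping.keys f"]
  by (auto simp: inflate_def lin_ext_def split: if_splits)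

text \<open>Dilation turns weight into total degree.\<close>

lemma homogeneous_inflate_weight_part: "homogeneous (inflate d (weight_part d e f))"
proof -
  have "(\<Sum>i\<in>UNIV. Poly_Mapping.lookup m i) = e" if m: "m \<in> Poly_Mapping.keys (inflate d (weight_part d e f))" for m
  proof -
    obtain m' where "m = dilate d m'" "m' \<in> Poly_Mapping.keys (weight_part d e f)"
      using m keys_inflate by blast
    then show ?thesis by (auto simp: in_keys_iff lookup_weight_part weight_def split: if_splits)
  qed
  then show ?thesis by (auto simp: homogeneous_def)
qed

text \<open>Inflated monomials see \<open>y i\<close> only through \<open>y i ^ d i = 1\<close>, so
  at this point every inflated monomial of weight \<open>e\<close> takes the value
  \<open>c ^ e\<close>.\<close>

lemma mpoly_eval_inflate_weight_part:
  assumes "\<And>i. y i ^ d i = 1"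
  shows "mpoly_eval (inflate d (weight_part d e f)) (c *s (\<chi> i. y i)) = c ^ e * weight_sum d e f"
proof (induction f rule: poly_mapping_induct)
  case (single m a)
  have "(\<Prod>i\<in>UNIV. (c * y i) ^ (d i * Poly_Mapping.lookup m i)) = (\<Prod>i\<in>UNIV. c ^ (d i * Poly_Mapping.lookup m i))"
    by (rule prod.cong) (simp_all add: power_mult power_mult_distrib assms)
  then show ?case
    by (auto simp: mpoly_subst_single inflate.zero mpoly_subst_def[of _ _ 0] weight_def power_sum)
next
  case (add f g)
  then show ?case by (simp add: weight_part_add inflate_add mpoly_subst_add weight_sum_add distrib_left)
qed

text \<open>For a reduced exponent \<open>b\<close>, the coefficient of \<open>t ^ b\<close> after
  reducing \<open>f\<close> modulo the polynomials \<open>t\<^sub>i ^ d\<^sub>i - 1\<close>.\<close>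

definition residue_sum :: "('n::finite \<Rightarrow> nat) \<Rightarrow> ('n \<Rightarrow>\<^sub>0 nat) \<Rightarrow> ('n, 'k::field) mpoly \<Rightarrow> 'k" where
  "residue_sum d b = lin_ext (\<lambda>m c. if expo_mod d m = b then c else 0)"

lemma residue_sum_single [simp]: "residue_sum d b (Poly_Mapping.single m c) = (if expo_mod d m = b then c else 0)"
  by (simp add: residue_sum_def lin_ext_single)

lemma residue_sum_add: "residue_sum d b (f + g) = residue_sum d b f + residue_sum d b g"
  unfolding residue_sum_def by (rule lin_ext_add) simp_all

lemma sum_expo_decomposition:
  "(\<Sum>i\<in>UNIV. Poly_Mapping.lookup m i) =
    (\<Sum>i\<in>UNIV. Poly_Mapping.lookup (expo_mod d m) i) + weight d (expo_div d m)"
  by (simp add: weight_def sum.distrib[symmetric])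

lemma weight_sum_slice:
  "weight_sum d e (slice d b f) = lin_ext (\<lambda>m c. if expo_mod d m = b \<and> weight d (expo_div d m) = e then c else 0) f"
proof (induction f rule: poly_mapping_induct)
  case (add f g)
  have "lin_ext (\<lambda>m c. if expo_mod d m = b \<and> weight d (expo_div d m) = e then c else 0) (f + g)
    = lin_ext (\<lambda>m c. if expo_mod d m = b \<and> weight d (expo_div d m) = e then c else 0) f +
      lin_ext (\<lambda>m c. if expo_mod d m = b \<and> weight d (expo_div d m) = e then c else 0) g"
    by (rule lin_ext_add) simp_all
  then show ?case using add by (simp add: slice_add weight_sum_add)
qed (simp add: lin_ext_single)

text \<open>In a homogeneous polynomial the residue \<open>b\<close> determines the weight of the
  quotient exponent. The slice thus lives in a single weight, where its weight sum is the whole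
  residue sum.\<close>

lemma weight_sum_slice_homogeneous:
  assumes "homogeneous f" "residue_sum d b f = 0"
  shows "weight_sum d e (slice d b f) = 0"
proof -
  obtain k where k: "\<And>m. m \<in> Poly_Mapping.keys f \<Longrightarrow> (\<Sum>i\<in>UNIV. Poly_Mapping.lookup m i) = k"
    using assms(1) by (auto simp: homogeneous_def)
  show ?thesis
  proof (cases "k = (\<Sum>i\<in>UNIV. Poly_Mapping.lookup b i) + e")
    case True
    have "weight_sum d e (slice d b f) = residue_sum d b f"
      unfolding weight_sum_slice residue_sum_def lin_ext_def
    proof (rule sum.cong[OF refl])
      fix m assume "m \<in> Poly_Mapping.keys f"
      then show "(if expo_mod d m = b \<and> weight d (expo_div d m) = e then Poly_Mapping.lookup f m else 0)
          = (if expo_mod d m = b then Poly_Mapping.lookup f m else 0)"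
        using k[of m] True sum_expo_decomposition[of m d] by (auto simp del: lookup_expo_mod)
    qed
    then show ?thesis using assms(2) by simp
  next
    case False
    show ?thesis
      unfolding weight_sum_slice lin_ext_def
    proof (rule sum.neutral, rule ballI)
      fix m assume "m \<in> Poly_Mapping.keys f"
      then show "(if expo_mod d m = b \<and> weight d (expo_div d m) = e then Poly_Mapping.lookup f m else 0) = 0"
        using k[of m] False sum_expo_decomposition[of m d] by (auto simp del: lookup_expo_mod)
    qed
  qed
qed

section \<open>Orthogonality of characters\<close>

context primitive_roots
begin

text \<open>A geometric sum over all powers of \<open>\<omega> i\<close>: it vanishes unless its
  ratio is 1.\<close>

lemma sum_root_powers:
  "(\<Sum>s<d i. (\<omega> i ^ s) ^ k) = (if d i dvd k then of_nat (d i) else 0)"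
proof (cases "d i dvd k")
  case True
  then have "(\<omega> i ^ s) ^ k = 1" for s
    by (metis power_mult mult.commute root_power power_one)
  then show ?thesis using True by simp
next
  case False
  have "(1 - \<omega> i ^ k) * (\<Sum>s<d i. (\<omega> i ^ k) ^ s) = 1 - (\<omega> i ^ k) ^ d i"
    by (simp add: one_diff_power_eq)
  also have "(\<omega> i ^ k) ^ d i = 1"
    by (metis power_mult root_power dvd_triv_right)
  finally have "(\<Sum>s<d i. (\<omega> i ^ k) ^ s) = 0" using False by (simp add: root_power)
  then show ?thesis using False by (simp add: power_mult[symmetric] mult.commute)
qed

text \<open>The sum over all points factors into one character sum per variable. The exponent
  \<open>d i\<close> minus \<open>b\<close> at \<open>i\<close> stands for the negative of
  \<open>b\<close> at \<open>i\<close>, since \<open>d i\<close> is a period.\<close>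

lemma fourier_inversion:
  assumes "b \<in> range (expo_mod d)"
  shows "(\<Sum>s\<in>PiE UNIV (\<lambda>i. {..<d i}). (\<Prod>i\<in>UNIV. (\<omega> i ^ s i) ^ (d i - Poly_Mapping.lookup b i)) *
      mpoly_eval f (\<chi> i. \<omega> i ^ s i)) = of_nat (\<Prod>i\<in>UNIV. d i) * residue_sum d b f"
proof (induction f rule: poly_mapping_induct)
  case (single m c)
  have b: "Poly_Mapping.lookup b i < d i" for i using assms d_pos by auto
  have dvd: "d i dvd d i - Poly_Mapping.lookup b i + Poly_Mapping.lookup m i \<longleftrightarrow>
      Poly_Mapping.lookup (expo_mod d m) i = Poly_Mapping.lookup b i" for i
  proof -
    have "int (d i - Poly_Mapping.lookup b i + Poly_Mapping.lookup m i) =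
        int (Poly_Mapping.lookup m i) - int (Poly_Mapping.lookup b i) + int (d i)"
      using b[of i] by simp
    then have "d i dvd d i - Poly_Mapping.lookup b i + Poly_Mapping.lookup m i \<longleftrightarrow>
        int (d i) dvd int (Poly_Mapping.lookup m i) - int (Poly_Mapping.lookup b i)"
      by (metis dvd_add_triv_right_iff int_dvd_int_iff)
    also have "\<dots> \<longleftrightarrow> Poly_Mapping.lookup m i mod d i = Poly_Mapping.lookup b i mod d i"
      by (metis mod_eq_dvd_iff of_nat_eq_iff zmod_int)
    finally show ?thesis using b[of i] by simp
  qed
  have "(\<Sum>s\<in>PiE UNIV (\<lambda>i. {..<d i}). (\<Prod>i\<in>UNIV. (\<omega> i ^ s i) ^ (d i - Poly_Mapping.lookup b i)) *
      mpoly_eval (Poly_Mapping.single m c) (\<chi> i. \<omega> i ^ s i))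
    = c * (\<Sum>s\<in>PiE UNIV (\<lambda>i. {..<d i}). \<Prod>i\<in>UNIV. (\<omega> i ^ s i) ^ (d i - Poly_Mapping.lookup b i + Poly_Mapping.lookup m i))"
    by (simp add: mpoly_subst_single sum_distrib_left power_add prod.distrib mult_ac)
  also have "\<dots> = c * (\<Prod>i\<in>UNIV. \<Sum>s<d i. (\<omega> i ^ s) ^ (d i - Poly_Mapping.lookup b i + Poly_Mapping.lookup m i))"
    by (subst prod_sum_PiE) auto
  also have "\<dots> = c * (\<Prod>i\<in>UNIV. if Poly_Mapping.lookup (expo_mod d m) i = Poly_Mapping.lookup b i then of_nat (d i) else 0)"
    by (simp only: sum_root_powers dvd)
  also have "\<dots> = of_nat (\<Prod>i\<in>UNIV. d i) * residue_sum d b (Poly_Mapping.single m c)"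
  proof (cases "expo_mod d m = b")
    case False
    then obtain i where "Poly_Mapping.lookup (expo_mod d m) i \<noteq> Poly_Mapping.lookup b i"
      by (metis poly_mapping_eqI)
    then have "(\<Prod>i\<in>UNIV. if Poly_Mapping.lookup (expo_mod d m) i = Poly_Mapping.lookup b i then of_nat (d i) else (0::'k)) = 0"
      by (intro prod_zero) auto
    then show ?thesis using False by (simp del: lookup_expo_mod)
  qed simp
  finally show ?case .
next
  case (add f g)
  then show ?case by (simp add: mpoly_subst_add residue_sum_add distrib_left sum.distrib)
qed

end

section \<open>Numbers of generators\<close>

text \<open>Steinitz exchange in the quotient by \<open>W\<close>, done without forming it: a basis
  \<open>B0\<close> of \<open>W\<close> is enlarged by elements of \<open>H\<close>, and the new
  elements form \<open>B\<close>.\<close>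

lemma (in vector_space) exchange_modulo_subspace:
  assumes A: "finite A" and H: "H \<subseteq> span (A \<union> W)" and W: "subspace W"
  obtains B where "B \<subseteq> H" "finite B" "card B \<le> card A" "H \<subseteq> span (B \<union> W)"
proof -
  obtain B0 where B0: "B0 \<subseteq> W" "independent B0" "W \<subseteq> span B0"
    using maximal_independent_subset[of W] by blast
  obtain B1 where B1: "B0 \<subseteq> B1" "B1 \<subseteq> B0 \<union> H" "independent B1" "B0 \<union> H \<subseteq> span B1"
    using maximal_independent_subset_extend[of B0 "B0 \<union> H"] B0(2) by blast
  define B where "B = B1 - B0"
  have AW: "A \<union> W \<subseteq> span (A \<union> B0)"
    using B0(3) span_mono[of B0 "A \<union> B0"] span_superset[of "A \<union> B0"] by blast
  have BH: "B \<subseteq> H" using B1(2) by (auto simp: B_def)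
  then have B_span: "B \<subseteq> span (A \<union> B0)"
    using H span_minimal[OF AW subspace_span] by blast
  \<comment> \<open>\<open>W\<close> may have infinite dimension, so finite subsets are counted.
    Expressing \<open>C\<close> uses only finitely many elements \<open>G\<close> of
    \<open>B0\<close>, and the size of \<open>G\<close> cancels from both sides of the
    bound.\<close>
  have card: "card C \<le> card A" if C: "finite C" "C \<subseteq> B" for C
  proof -
    have "\<exists>F. finite F \<and> F \<subseteq> B0 \<and> c \<in> span (A \<union> F)" if c: "c \<in> C" for c
    proof -
      have "c \<in> span (A \<union> B0)" using c C(2) B_span by blast
      then obtain t r where t: "finite t" "t \<subseteq> A \<union> B0" "c = (\<Sum>a\<in>t. scale (r a) a)"
        unfolding span_explicit by blast
      have "c \<in> span (A \<union> (t \<inter> B0))"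
        unfolding t(3) using t(2) by (intro span_sum span_scale span_base) blast
      then show ?thesis using t(1) by blast
    qed
    then obtain F where F: "\<And>c. c \<in> C \<Longrightarrow> finite (F c) \<and> F c \<subseteq> B0 \<and> c \<in> span (A \<union> F c)"
      by metis
    define G where "G = (\<Union>c\<in>C. F c)"
    have G: "finite G" "G \<subseteq> B0" using F C(1) by (auto simp: G_def)
    have "C \<subseteq> span (A \<union> G)"
    proof
      fix c assume c: "c \<in> C"
      have "A \<union> F c \<subseteq> A \<union> G" using c by (auto simp: G_def)
      then show "c \<in> span (A \<union> G)" using F[OF c] span_mono by blast
    qed
    then have "C \<union> G \<subseteq> span (A \<union> G)" using span_superset[of "A \<union> G"] by blast
    moreover have "independent (C \<union> G)"
      using B1(3) by (rule independent_mono) (use C(2) G(2) B1(1) in \<open>auto simp: B_def\<close>)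
    ultimately have "card (C \<union> G) \<le> card (A \<union> G)"
      using independent_span_bound[of "A \<union> G" "C \<union> G"] A G(1) by blast
    moreover have "card (C \<union> G) = card C + card G"
      using C G by (intro card_Un_disjoint) (auto simp: B_def)
    ultimately show ?thesis using card_Un_le[of A G] by linarith
  qed
  have finB: "finite B"
  proof (rule ccontr)
    assume "infinite B"
    then obtain C where "C \<subseteq> B" "finite C" "card C = Suc (card A)"
      using infinite_arbitrarily_large by blast
    then show False using card[of C] by simp
  qed
  have "B1 \<subseteq> B \<union> W" using B0(1) by (auto simp: B_def)
  then have "H \<subseteq> span (B \<union> W)" using B1(4) span_mono by blast
  then show ?thesis using that BH finB card[OF finB] by blast
qed

section \<open>Generators modulo multiples by polynomials without constant term\<close>

abbreviation const :: "'k \<Rightarrow> ('n::finite, 'k::field) mpoly" where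
  "const \<equiv> Poly_Mapping.single 0"

text \<open>Here the scalars are the constants only, in contrast to \<open>idl\<close>, whose
  scalars are all polynomials.\<close>

interpretation mpv: vector_space "\<lambda>c f :: ('n::finite, 'k::field) mpoly. const c * f"
  by unfold_locales (simp_all add: algebra_simps single_add mult_single mult.assoc[symmetric])

lemma lookup_mult_zero:
  fixes f g :: "('n::finite, 'k::field) mpoly"
  shows "Poly_Mapping.lookup (f * g) 0 = Poly_Mapping.lookup f 0 * Poly_Mapping.lookup g 0"
proof (induction f rule: poly_mapping_induct)
  case (single m c)
  have "m + m' = 0 \<longleftrightarrow> m = 0 \<and> m' = 0" for m' :: "'n \<Rightarrow>\<^sub>0 nat"
    by (auto simp: poly_mapping_eq_iff plus_poly_mapping.rep_eq fun_eq_iff)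
  then show ?case
    by (induction g rule: poly_mapping_induct)
      (auto simp: mult_single lookup_single when_def distrib_left lookup_add)
qed (simp add: distrib_right lookup_add)

lemma lookup_slice_zero: 
  assumes "\<And>i. d i > 0"
  shows "Poly_Mapping.lookup (slice d 0 f) 0 = Poly_Mapping.lookup f 0"
proof (induction f rule: poly_mapping_induct)
  case (single m c)
  have "m = 0" if "expo_mod d m = 0" "expo_div d m = 0"
    using expo_mod_add_dilate_div[of d m] that by simp
  moreover have "expo_mod d 0 = 0" "expo_div d 0 = 0" by (auto intro: poly_mapping_eqI)
  ultimately show ?case by (auto simp: lookup_single when_def)
qed (simp add: slice_add lookup_add)

text \<open>The \<open>K\<close>-span of \<open>\<mm>P\<close>, where \<open>\<mm>\<close> is generated by the variables.\<close>

definition irrelevant_mult :: "('n::finite, 'k::field) mpoly set \<Rightarrow> ('n, 'k) mpoly set" where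
  "irrelevant_mult P = mpv.span {a * p | a p. Poly_Mapping.lookup a 0 = 0 \<and> p \<in> P}"

lemma irrelevant_multI:
  "Poly_Mapping.lookup a 0 = 0 \<Longrightarrow> p \<in> P \<Longrightarrow> a * p \<in> irrelevant_mult P"
  unfolding irrelevant_mult_def by (rule mpv.span_base) blast

text \<open>On a multiple \<open>c * inflate d p\<close> the slice of the product is
  \<open>slice d 0 (a * c) * p\<close>, and the first factor inherits from \<open>a\<close> the
  absence of a constant term.\<close>

lemma slice_zero_mult_extension:
  assumes d: "\<And>i. d i > 0" and v: "v \<in> inflate.extension d P" and a: "Poly_Mapping.lookup a 0 = 0"
  shows "slice d 0 (a * v) \<in> irrelevant_mult P"
  using v unfolding inflate.extension_def
proof (induction rule: idl.span_induct_alt)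
  case base
  then show ?case by (simp add: irrelevant_mult_def mpv.span_zero)
next
  case (step c x y)
  then obtain p where p: "p \<in> P" "x = inflate d p" by blast
  have "slice d 0 (a * (c * x)) = slice d 0 (a * c) * p"
    using slice_inflate_mult[where b = 0 and f = p and g = "a * c", OF d] p(2) by (simp add: mult_ac)
  moreover have "Poly_Mapping.lookup (slice d 0 (a * c)) 0 = 0"
    by (simp add: lookup_slice_zero d lookup_mult_zero a)
  ultimately have "slice d 0 (a * (c * x)) \<in> irrelevant_mult P"
    using irrelevant_multI p(1) by metis
  then show ?case
    using step.IH by (simp add: distrib_left slice_add irrelevant_mult_def mpv.span_add)
qed

lemma slice_const_mult: 
  assumes "\<And>i. d i > 0"
  shows "slice d b (const c * f) = const c * slice d b f"
  using slice_inflate_mult[where b = b and f = "const c" and g = f, OF assms] by simp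

text \<open>An inflated element of \<open>P\<close> is a combination of \<open>S\<close>. After
  slicing, the constant terms of its coefficients act as scalars and the remainders fall into
  \<open>irrelevant_mult P\<close>.\<close>

lemma extension_generators_span:
  assumes d: "\<And>i. d i > 0" and S: "finite S" "idl.span S = inflate.extension d P"
  shows "P \<subseteq> mpv.span (slice d 0 ` S \<union> irrelevant_mult P)"
proof
  fix p assume "p \<in> P"
  then have "inflate d p \<in> idl.span S" using S(2) inflate.extension_base by blast
  then obtain u where u: "inflate d p = (\<Sum>v\<in>S. u v * v)"
    unfolding idl.span_finite[OF S(1)] by blast
  have "p = (\<Sum>v\<in>S. slice d 0 (u v * v))"
  proof -
    have "p = slice d 0 (inflate d p)" by (simp add: slice_zero_inflate d)
    also have "slice d 0 (\<Sum>v\<in>S. g v) = (\<Sum>v\<in>S. slice d 0 (g v))" for g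
      by (induction S rule: infinite_finite_induct) (simp_all add: slice_add)
    then have "slice d 0 (inflate d p) = (\<Sum>v\<in>S. slice d 0 (u v * v))"
      by (simp add: u)
    finally show ?thesis .
  qed
  also have "\<dots> \<in> mpv.span (slice d 0 ` S \<union> irrelevant_mult P)"
  proof (rule mpv.span_sum)
    fix v assume v: "v \<in> S"
    define c where "c = Poly_Mapping.lookup (u v) 0"
    have vE: "v \<in> inflate.extension d P" using S(2) idl.span_base[OF v] by simp
    have "u v * v = const c * v + (u v - const c) * v" by (simp add: algebra_simps)
    then have "slice d 0 (u v * v) = const c * slice d 0 v + slice d 0 ((u v - const c) * v)"
      by (simp add: slice_add slice_const_mult d)
    moreover have "slice d 0 ((u v - const c) * v) \<in> irrelevant_mult P"
      by (rule slice_zero_mult_extension[OF d vE]) (simp add: c_def lookup_minus)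
    ultimately show "slice d 0 (u v * v) \<in> mpv.span (slice d 0 ` S \<union> irrelevant_mult P)"
      using v by (auto intro!: mpv.span_add intro: mpv.span_scale mpv.span_base)
  qed
  finally show "p \<in> mpv.span (slice d 0 ` S \<union> irrelevant_mult P)" .
qed

section \<open>Weighted homogeneous generators and the graded Nakayama lemma\<close>

lemma weight_part_single_mult: "weight_part d e (Poly_Mapping.single m c * f) =
    (if weight d m \<le> e then Poly_Mapping.single m c * weight_part d (e - weight d m) f else 0)"
  by (induction f rule: poly_mapping_induct)
    (auto simp: mult_single weight_add weight_part_add distrib_left)

lemma weight_part_0 [simp]: "weight_part d e 0 = 0"
  by (simp add: weight_part_def lin_ext_def)

lemma weight_0 [simp]: "weight d 0 = 0"
  by (simp add: weight_def)

lemma weight_pos: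
  assumes "\<And>i. d i > 0" "m \<noteq> 0"
  shows "weight d m > 0"
proof -
  obtain i where "Poly_Mapping.lookup m i \<noteq> 0" using assms(2) by (metis poly_mapping_eqI lookup_zero)
  then show ?thesis using assms(1)[of i] by (auto simp: weight_def sum_pos2)
qed

lemma weight_part_sum: "weight_part d e (\<Sum>x\<in>A. g x) = (\<Sum>x\<in>A. weight_part d e (g x))"
  by (induction A rule: infinite_finite_induct) (simp_all add: weight_part_add)

text \<open>Monomials other than 1 have positive weight, so the part of weight \<open>e\<close> of a
  product in \<open>irrelevant_mult P\<close> involves only parts of \<open>P\<close> of smaller
  weight; induction on \<open>e\<close> applies.\<close>

lemma graded_nakayama:
  assumes d: "\<And>i. d i > 0"
    and P: "idl.subspace P" "\<And>f e. f \<in> P \<Longrightarrow> weight_part d e f \<in> P"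
    and B: "B \<subseteq> {weight_part d e f | e f. f \<in> P}"
    and span: "P \<subseteq> mpv.span (B \<union> irrelevant_mult P)"
  shows "idl.span B = P"
proof
  have "B \<subseteq> P" using B P(2) by blast
  then show "idl.span B \<subseteq> P" using P(1) by (rule idl.span_minimal)
  let ?I = "{a * p | a p. Poly_Mapping.lookup a 0 = 0 \<and> p \<in> P}"
  have "B \<union> irrelevant_mult P \<subseteq> mpv.span (B \<union> ?I)"
    unfolding irrelevant_mult_def using mpv.span_mono[of ?I "B \<union> ?I"] mpv.span_superset[of "B \<union> ?I"] by blast
  then have span': "P \<subseteq> mpv.span (B \<union> ?I)"
    using span mpv.span_minimal[of "B \<union> irrelevant_mult P", OF _ mpv.subspace_span] by blast
  have part: "weight_part d e f \<in> idl.span B" if "f \<in> P" for e f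
    using that
  proof (induction e arbitrary: f rule: less_induct)
    case (less e)
    have "f \<in> mpv.span (B \<union> ?I)" using less.prems span' by blast
    then show ?case
    proof (induction rule: mpv.span_induct_alt)
      case base
      then show ?case by (simp add: idl.span_zero)
    next
      case (step c x y)
      have "weight_part d e x \<in> idl.span B"
      proof (cases "x \<in> B")
        case True
        then obtain e' g where "x = weight_part d e' g" using B by blast
        \<comment> \<open>Elements of \<open>B\<close> are weighted homogeneous, so taking a part
          does not lead out of the ideal they generate.\<close>
        then have "weight_part d e x = x \<or> weight_part d e x = 0"
          by (simp add: weight_part_weight_part)
        then show ?thesis using idl.span_base[OF True] idl.span_zero[of B] by metis
      next
        case False
        then obtain a p where ap: "x = a * p" "Poly_Mapping.lookup a 0 = 0" "p \<in> P"
          using step.hyps by blast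
        have "x = (\<Sum>m\<in>Poly_Mapping.keys a. Poly_Mapping.single m (Poly_Mapping.lookup a m) * p)"
          unfolding ap(1) by (subst (1) poly_mapping_sum_single[of a]) (rule sum_distrib_right)
        then have "weight_part d e x = (\<Sum>m\<in>Poly_Mapping.keys a.
            weight_part d e (Poly_Mapping.single m (Poly_Mapping.lookup a m) * p))"
          by (simp add: weight_part_sum)
        also have "\<dots> \<in> idl.span B"
        proof (rule idl.span_sum)
          fix m assume "m \<in> Poly_Mapping.keys a"
          then have "m \<noteq> 0" using ap(2) by (auto simp: in_keys_iff)
          then have "weight d m > 0" by (rule weight_pos[of d, OF d])
          then show "weight_part d e (Poly_Mapping.single m (Poly_Mapping.lookup a m) * p) \<in> idl.span B"
            using less.IH[of "e - weight d m" p] ap(3)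
            by (simp add: weight_part_single_mult idl.span_zero idl.span_scale)
        qed
        finally show ?thesis .
      qed
      then show ?case
        using step.IH by (simp add: weight_part_add weight_part_single_mult idl.span_add idl.span_scale)
    qed
  qed
  show "P \<subseteq> idl.span B"
  proof
    fix f assume "f \<in> P"
    then have "(\<Sum>e\<in>weight d ` Poly_Mapping.keys f. weight_part d e f) \<in> idl.span B"
      by (intro idl.span_sum part)
    then show "f \<in> idl.span B" using weight_part_decomposition[of f d] by simp
  qed
qed

lemma weighted_homogeneous_span:
  assumes "\<And>f e. f \<in> P \<Longrightarrow> weight_part d e f \<in> P"
  shows "P \<subseteq> mpv.span {weight_part d e f | e f. f \<in> P}"
proof
  fix f assume "f \<in> P"
  then have "(\<Sum>e\<in>weight d ` Poly_Mapping.keys f. weight_part d e f) \<in> mpv.span {weight_part d e f | e f. f \<in> P}"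
    by (intro mpv.span_sum mpv.span_base) blast
  then show "f \<in> mpv.span {weight_part d e f | e f. f \<in> P}"
    using weight_part_decomposition[of f d] by simp
qed

theorem generators_from_extension:
  assumes d: "\<And>i. d i > 0"
    and P: "idl.subspace P" "\<And>f e. f \<in> P \<Longrightarrow> weight_part d e f \<in> P"
    and S: "finite S" "idl.span S = inflate.extension d P"
  obtains B where "finite B" "card B \<le> card S" "idl.span B = P"
proof -
  \<comment> \<open>The slices of \<open>S\<close> need not be weighted homogeneous. Drawing the new
    generators from this set makes the graded Nakayama lemma applicable.\<close>
  let ?H = "{weight_part d e f | e f. f \<in> P}"
  have HP: "?H \<subseteq> P" using P(2) by blast
  have "?H \<subseteq> mpv.span (slice d 0 ` S \<union> irrelevant_mult P)"
    using HP extension_generators_span[of d, OF d S] by blast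
  moreover have "mpv.subspace (irrelevant_mult P)"
    by (simp add: irrelevant_mult_def mpv.subspace_span)
  ultimately obtain B where B: "B \<subseteq> ?H" "finite B" "card B \<le> card (slice d 0 ` S)"
    "?H \<subseteq> mpv.span (B \<union> irrelevant_mult P)"
    using mpv.exchange_modulo_subspace[of "slice d 0 ` S" ?H "irrelevant_mult P"] S(1) by blast
  have "P \<subseteq> mpv.span (B \<union> irrelevant_mult P)"
    using weighted_homogeneous_span[of P d] P(2) mpv.span_minimal[OF B(4) mpv.subspace_span] by blast
  then have "idl.span B = P"
    using graded_nakayama[of d P B] d P B(1) by blast
  moreover have "card B \<le> card S"
    using B(3) card_image_le[OF S(1), of "slice d 0"] by linarith
  ultimately show ?thesis using that B(2) by blast
qed

section \<open>Complete intersections\<close>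

lemma of_nat_CARD_eq_0: "of_nat CARD('a) = (0 :: 'a::{ring_1,finite})"
proof -
  \<comment> \<open>Translation by 1 permutes the ring, so the added ones sum to zero.\<close>
  have "(\<Sum>x\<in>(UNIV :: 'a set). x + 1) = (\<Sum>x\<in>UNIV. x)"
    by (rule sum.reindex_bij_betw) (rule bij_plus_right)
  then show ?thesis by (simp add: sum.distrib)
qed

text \<open>The number of units is -1 in the field, so its divisors are nonzero there. This allows
  division by the factor in Fourier inversion.\<close>

lemma of_nat_neq_0_if_dvd_pred_CARD:
  assumes "k dvd CARD('a) - 1"
  shows "of_nat k \<noteq> (0 :: 'a::{field,finite})"
proof
  assume "of_nat k = (0 :: 'a)"
  then have "of_nat (CARD('a) - 1) = (0 :: 'a)"
    using assms by (metis dvdE mult_zero_left of_nat_mult)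
  moreover have "of_nat (CARD('a) - 1) + 1 = (of_nat CARD('a) :: 'a)"
    by (metis Suc_pred' add.commute of_nat_Suc zero_less_card_finite)
  ultimately show False using of_nat_CARD_eq_0[where 'a = 'a] by simp
qed

lemma units_group_simps:
  "carrier (units_group :: 'k::field monoid) = - {0}"
  "monoid.mult (units_group :: 'k monoid) = (*)"
  "one (units_group :: 'k monoid) = 1"
  by (auto simp: ring_of_type_algebra_def mult_of_def)

text \<open>\<^const>\<open>Multiplicative_Group.mult_of\<close> and \<^const>\<open>Ring_Divisibility.mult_of\<close> are distinct constants with
  the same definition; \<open>units_group\<close> is formed with the latter, while \<open>field_mult_group\<close> is about
  the former.\<close>

lemma group_units_group: "group (units_group :: 'k::field monoid)"
  using field.field_mult_group[OF field_from_type_algebra]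
  unfolding Multiplicative_Group.mult_of_def Ring_Divisibility.mult_of_def .

lemma units_group_pow: "x [^]\<^bsub>units_group\<^esub> (n :: nat) = (x :: 'k::field) ^ n"
  by (induction n) (simp_all add: nat_pow_def ring_of_type_algebra_def mult.commute)

text \<open>Vanishing on the torus kills all residue sums by Fourier inversion, which puts the
  slices into the toric ideal. Conversely, up to a common scalar the coordinates of points of the
  torus are roots of unity of orders dividing the \<open>d i\<close>.\<close>

lemma (in primitive_roots) vanishing_ideal_eq_extension:
  assumes \<omega>: "\<And>i. \<omega> i = \<beta> ^ v i"
    and \<beta>: "\<beta> \<noteq> 0"
    and gen: "\<And>x. x \<noteq> 0 \<Longrightarrow> \<exists>k::nat. x = \<beta> ^ k"
    and d_inv: "\<And>i. of_nat (d i) \<noteq> (0 :: 'k)"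
  shows "vanishing_ideal (degenerate_torus v) = inflate.extension d (toric_ideal d :: ('n, 'k) mpoly set)"
proof
  let ?V = "{f :: ('n, 'k) mpoly. homogeneous f \<and> (\<forall>Q\<in>degenerate_torus v. \<forall>x\<in>Q. mpoly_eval f x = 0)}"
  show "vanishing_ideal (degenerate_torus v) \<subseteq> inflate.extension d (toric_ideal d :: ('n, 'k) mpoly set)"
    unfolding vanishing_ideal_def genideal_ring_of_type
  proof (rule idl.span_minimal[OF _ inflate.subspace_extension], rule subsetI)
    fix f assume f: "f \<in> ?V"
    have eval: "mpoly_eval f (\<chi> i. \<omega> i ^ s i) = 0" for s
    proof -
      have "proj_point (\<chi> i. (\<beta> ^ s i) ^ v i) \<in> degenerate_torus v"
        unfolding degenerate_torus_def using \<beta> by (auto intro!: exI[of _ "\<lambda>i. \<beta> ^ s i"])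
      moreover have "(\<chi> i. \<omega> i ^ s i) \<in> proj_point (\<chi> i. (\<beta> ^ s i) ^ v i)"
        unfolding proj_point_def
        by (auto intro!: exI[of _ 1] simp: \<omega> vec_eq_iff power_mult[symmetric] mult.commute)
      ultimately show ?thesis using f by blast
    qed
    have "residue_sum d b f = 0" if "b \<in> range (expo_mod d)" for b
      using fourier_inversion[OF that, of f] unfolding eval by (simp add: d_inv)
    \<comment> \<open>Exponents that are not remainders give an empty sum, so the conclusion holds
      for every \<open>b\<close>.\<close>
    moreover have "residue_sum d b f = 0" if "b \<notin> range (expo_mod d)" for b
      using that by (auto simp: residue_sum_def lin_ext_def intro!: sum.neutral)
    ultimately have "residue_sum d b f = 0" for b by blast
    then show "f \<in> inflate.extension d (toric_ideal d)"
      using f unfolding mem_extension_iff[of d, OF d_pos subspace_toric_ideal] mem_toric_ideal_iff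
      by (simp add: weight_sum_slice_homogeneous)
  qed
  show "inflate.extension d (toric_ideal d :: ('n, 'k) mpoly set) \<subseteq> vanishing_ideal (degenerate_torus v)"
    unfolding vanishing_ideal_def genideal_ring_of_type inflate.extension_def
  proof (rule idl.span_minimal[OF _ idl.subspace_span], rule subsetI)
    fix f :: "('n, 'k) mpoly" assume "f \<in> inflate d ` toric_ideal d"
    then obtain p where p: "f = inflate d p" "p \<in> toric_ideal d" by blast
    \<comment> \<open>An inflated toric polynomial need not be homogeneous, but its weight parts
      inflate to homogeneous ones.\<close>
    have "f = (\<Sum>e\<in>weight d ` Poly_Mapping.keys p. inflate d (weight_part d e p))"
      unfolding p(1) by (subst (1) weight_part_decomposition[of p d]) (rule inflate_sum)
    also have "\<dots> \<in> idl.span ?V"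
    proof (rule idl.span_sum, rule idl.span_base, rule CollectI, intro conjI ballI)
      fix e show "homogeneous (inflate d (weight_part d e p))"
        by (rule homogeneous_inflate_weight_part)
      fix Q :: "('k ^ 'n) set" and x assume "Q \<in> degenerate_torus v" "x \<in> Q"
      then obtain z c where z: "\<And>i. z i \<noteq> 0" and x: "x = c *s (\<chi> i. z i ^ v i)"
        by (auto simp: degenerate_torus_def proj_point_def)
      have "(z i ^ v i) ^ d i = 1" for i
      proof -
        obtain k where "z i = \<beta> ^ k" using gen[OF z] by blast
        then have "(z i ^ v i) ^ d i = (\<omega> i ^ d i) ^ k"
          by (simp add: \<omega> power_mult[symmetric] mult_ac)
        then show ?thesis using root_power[of i "d i"] by simp
      qed
      then have "mpoly_eval (inflate d (weight_part d e p)) x = c ^ e * weight_sum d e p"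
        unfolding x by (rule mpoly_eval_inflate_weight_part)
      then show "mpoly_eval (inflate d (weight_part d e p)) x = 0"
        using p(2) by (simp add: mem_toric_ideal_iff)
    qed
    finally show "f \<in> idl.span ?V" .
  qed
qed

section \<open>Transfer of the complete intersection property\<close>

lemma complete_intersection_iff:
  "complete_intersection ring_of_type_algebra I \<longleftrightarrow>
    (\<exists>fs. I = idl.span (set fs) \<and> enat (length fs) = ideal_height ring_of_type_algebra (I :: 'a::comm_ring_1 set))"
proof -
  have "carrier (ring_of_type_algebra :: 'a ring) = UNIV" by (simp add: ring_of_type_algebra_def)
  then show ?thesis by (auto simp: complete_intersection_def genideal_ring_of_type)
qed

lemma (in primitive_roots) complete_intersection_extension_iff:
  assumes P: "idl.subspace P" "\<And>f e. f \<in> P \<Longrightarrow> weight_part d e f \<in> P"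
  shows "complete_intersection ring_of_type_algebra (inflate.extension d P) \<longleftrightarrow>
    complete_intersection ring_of_type_algebra (P :: ('n, 'k) mpoly set)"
proof
  assume "complete_intersection ring_of_type_algebra P"
  then obtain fs where fs: "P = idl.span (set fs)" "enat (length fs) = ideal_height ring_of_type_algebra P"
    unfolding complete_intersection_iff by blast
  have "inflate.extension d P = idl.span (set (map (inflate d) fs))"
    by (simp add: fs(1) inflate.extension_span)
  moreover have "enat (length (map (inflate d) fs)) = ideal_height ring_of_type_algebra (inflate.extension d P)"
    by (simp add: fs(2) ideal_height_inflate)
  ultimately show "complete_intersection ring_of_type_algebra (inflate.extension d P)"
    unfolding complete_intersection_iff by blast
next
  assume "complete_intersection ring_of_type_algebra (inflate.extension d P)"
  then obtain fs where fs: "inflate.extension d P = idl.span (set fs)"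
    "enat (length fs) = ideal_height ring_of_type_algebra (inflate.extension d P)"
    unfolding complete_intersection_iff by blast
  obtain B where B: "finite B" "card B \<le> card (set fs)" "idl.span B = P"
    using generators_from_extension[of d P "set fs"] d_pos P fs(1) by auto
  obtain bs where bs: "set bs = B" "distinct bs" using finite_distinct_list[OF B(1)] by blast
  \<comment> \<open>The list must have length equal to the height, while \<open>B\<close> may be
    smaller; zeros fill the gap without changing the ideal.\<close>
  define gs where "gs = bs @ replicate (length fs - length bs) 0"
  have "length bs \<le> length fs"
    using B(2) bs distinct_card[OF bs(2)] card_length[of fs] by simp
  then have "length gs = length fs" by (simp add: gs_def)
  moreover have "idl.span (set gs) = P"
  proof
    have "set gs \<subseteq> idl.span B"
      using idl.span_base[of _ B] idl.span_zero[of B] by (auto simp: gs_def bs(1))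
    then show "idl.span (set gs) \<subseteq> P" using idl.span_minimal[of "set gs" P] B(3) P(1) by blast
    show "P \<subseteq> idl.span (set gs)"
      unfolding B(3)[symmetric] by (rule idl.span_mono) (auto simp: gs_def bs(1))
  qed
  ultimately show "complete_intersection ring_of_type_algebra P"
    unfolding complete_intersection_iff using fs(2) by (auto simp: ideal_height_inflate)
qed

theorem corollary3p7:
  fixes v d :: "'n::finite \<Rightarrow> nat"
    and \<beta> :: "'k::{field,finite}"
  assumes v_pos: "\<And>i. v i > 0"
    and \<beta>: "\<beta> \<in> carrier units_group"
         "generate units_group {\<beta>} = carrier units_group"
    and d: "\<And>i. d i = group.ord units_group (\<beta> [^]\<^bsub>units_group\<^esub> v i)"
  shows "complete_intersection mpoly_ring
           (vanishing_ideal (degenerate_torus v) :: ('n, 'k) mpoly set) \<longleftrightarrow>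
         complete_intersection mpoly_ring (toric_ideal d :: ('n, 'k) mpoly set)"
proof -
  interpret U: group "units_group :: 'k monoid" by (rule group_units_group)
  have fin: "finite (carrier (units_group :: 'k monoid))" by simp
  have \<beta>v: "\<beta> [^]\<^bsub>units_group\<^esub> v i \<in> carrier units_group" for i
    using \<beta>(1) by (rule U.nat_pow_closed)
  have roots: "primitive_roots d (\<lambda>i. \<beta> ^ v i)"
  proof
    fix i k
    show "d i > 0"
      using U.ord_ge_1[OF fin \<beta>v[of i]] by (simp add: d)
    show "(\<beta> ^ v i) ^ k = 1 \<longleftrightarrow> d i dvd k"
      using U.pow_eq_id[OF \<beta>v[of i], of k] by (simp only: d units_group_pow units_group_simps)
  qed
  \<comment> \<open>In a finite group the subgroup generated by one element consists of its natural
    powers.\<close>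
  have gen: "\<exists>k::nat. x = \<beta> ^ k" if "x \<noteq> 0" for x
    using U.generate_pow_on_finite_carrier[OF fin \<beta>(1)] \<beta>(2) that
    by (auto simp del: carrier_mult_of simp: units_group_pow units_group_simps)
  have \<beta>0: "\<beta> \<noteq> 0" using \<beta>(1) unfolding units_group_simps by simp
  have "of_nat (d i) \<noteq> (0 :: 'k)" for i
  proof (rule of_nat_neq_0_if_dvd_pred_CARD)
    have "Coset.order (units_group :: 'k monoid) = CARD('k) - 1"
      unfolding Coset.order_def units_group_simps by (simp add: Compl_eq_Diff_UNIV card_Diff_singleton)
    then show "d i dvd CARD('k) - 1"
      using U.ord_dvd_group_order[OF \<beta>v[of i]] by (simp add: d)
  qed
  then have "vanishing_ideal (degenerate_torus v) = inflate.extension d (toric_ideal d :: ('n, 'k) mpoly set)"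
    by (intro primitive_roots.vanishing_ideal_eq_extension[OF roots refl _ gen])
      (use \<beta>0 in simp_all)
  then show ?thesis
    using primitive_roots.complete_intersection_extension_iff[OF roots subspace_toric_ideal weight_part_toric_ideal]
    by simp
qed

end
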